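(* In the example setting, suppose $b_1(g)+b_2(g)\in(-2,0)$ or $b_1(h)+b_2(h)\in(-2,0)$. Then there exist $f_0\in L_2(G)$ and a generalized solution $u\in W^1(G)$ of problem (E) with right-hand side $f_0$, $f_1=0$, $f_2=0$ such that $u\notin W^2(G)$.
   Context: Example setting. $G\subset\mathbb R^2$ is a bounded domain with $\partial G=\Gamma_1\cup\Gamma_2\cup\{g,h\}$, where $\Gamma_1,\Gamma_2$ are disjoint open (in $\partial G$) $C^\infty$ curves with common endpoints $g,h$, and in a neighbourhood of each of $g,h$ the domain $G$ coincides with a half-plane (a plane angle of opening $\pi$). $b_1,b_2,a$ are real-valued $C^\infty$ functions. For $i=1,2$, $\Omega_i$ is a $C^\infty$ diffeomorphism of a neighbourhood of $\Gamma_i$ onto its image with $\Omega_i(\Gamma_i)\subset G$, $\Omega_i(g)=g$, $\Omega_i(h)=h$, and near each of $g,h$ the map $\Omega_i$ is the rotation about that point through the angle $\pi/2$ taking $\Gamma_i$ into $G$. $\Omega$ is a $C^\infty$ diffeomorphism of a neighbourhood of $\Gamma_1$ onto its image with $\Omega(\Gamma_1)\subset G$ and $\overline{\Omega(\Gamma_1)}\cap\{g,h\}=\emptyset$. Problem (E): $\Delta u=f_0$ in $G$; $u|_{\Gamma_1}+b_1(y)u(\Omega_1(y))|_{\Gamma_1}+a(y)u(\Omega(y))|_{\Gamma_1}=f_1$ on $\Gamma_1$; $u|_{\Gamma_2}+b_2(y)u(\Omega_2(y))|_{\Gamma_2}=f_2$ on $\Gamma_2$. $W^k=W^k_2$ are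 Sobolev spaces and $W^{k-1/2}(\Gamma_i)$ the trace spaces. A generalized solution with right-hand side $f_0\in L_2(G)$, $f_i\in W^{1/2}(\Gamma_i)$ is $u\in W^1(G)$ satisfying the equation in the sense of distributions and the nonlocal conditions in the sense of traces. *)

theory Defs
  imports "HOL-Analysis.Analysis"
begin

text \<open>The plane is modelled by the type complex (so that rotations by pi/2 are
multiplication by i or -i). Derivatives are Frechet derivatives.\<close>

fun ddl :: "'a::real_normed_vector list \<Rightarrow> ('a \<Rightarrow> 'b::real_normed_vector) \<Rightarrow> 'a \<Rightarrow> 'b" where
  "ddl [] f = f"
| "ddl (v # vs) f = (\<lambda>z. frechet_derivative (ddl vs f) (at z) v)"

definition Cinf_on :: "'a::real_normed_vector set \<Rightarrow> ('a \<Rightarrow> 'b::real_normed_vector) \<Rightarrow> bool" where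
  "Cinf_on S f \<longleftrightarrow> (\<forall>vs. ddl vs f differentiable_on S)"

definition Cinf_diffeo_on :: "complex set \<Rightarrow> (complex \<Rightarrow> complex) \<Rightarrow> bool" where
  "Cinf_diffeo_on U F \<longleftrightarrow> open U \<and> Cinf_on U F \<and> inj_on F U \<and> open (F ` U)
      \<and> Cinf_on (F ` U) (inv_into U F)"

definition L2 :: "'a::euclidean_space set \<Rightarrow> ('a \<Rightarrow> real) \<Rightarrow> bool" where
  "L2 S u \<longleftrightarrow> u \<in> borel_measurable (lebesgue_on S) \<and> integrable (lebesgue_on S) (\<lambda>z. (u z)\<^sup>2)"

definition test_fn :: "complex set \<Rightarrow> (complex \<Rightarrow> real) \<Rightarrow> bool" where
  "test_fn G \<phi> \<longleftrightarrow> Cinf_on UNIV \<phi> \<and> compact (closure {z. \<phi> z \<noteq> 0})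
      \<and> closure {z. \<phi> z \<noteq> 0} \<subseteq> G"

definition weak_deriv :: "complex set \<Rightarrow> complex \<Rightarrow> (complex \<Rightarrow> real) \<Rightarrow> (complex \<Rightarrow> real) \<Rightarrow> bool" where
  "weak_deriv G v u w \<longleftrightarrow> (\<forall>\<phi>. test_fn G \<phi> \<longrightarrow>
      integral\<^sup>L (lebesgue_on G) (\<lambda>z. u z * ddl [v] \<phi> z)
        = - integral\<^sup>L (lebesgue_on G) (\<lambda>z. w z * \<phi> z))"

definition W1 :: "complex set \<Rightarrow> (complex \<Rightarrow> real) \<Rightarrow> bool" where
  "W1 G u \<longleftrightarrow> L2 G u \<and> (\<forall>v\<in>{1, \<i>}. \<exists>w. L2 G w \<and> weak_deriv G v u w)"

definition W2 :: "complex set \<Rightarrow> (complex \<Rightarrow> real) \<Rightarrow> bool" where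
  "W2 G u \<longleftrightarrow> W1 G u \<and> (\<forall>v\<in>{1, \<i>}. \<exists>w. W1 G w \<and> weak_deriv G v u w)"

definition lap :: "(complex \<Rightarrow> real) \<Rightarrow> complex \<Rightarrow> real" where
  "lap \<phi> z = ddl [1, 1] \<phi> z + ddl [\<i>, \<i>] \<phi> z"

text \<open>Smooth regular arc parametrised over [0,1]; the open curve is gamma ` {0<..<1}.\<close>
definition smooth_arc :: "(real \<Rightarrow> complex) \<Rightarrow> bool" where
  "smooth_arc \<gamma> \<longleftrightarrow> (\<exists>e>0. Cinf_on {-e<..<1+e} \<gamma>) \<and> inj_on \<gamma> {0..1}
      \<and> (\<forall>t\<in>{0..1}. frechet_derivative \<gamma> (at t) 1 \<noteq> 0)"

text \<open>Trace: w (as a function of the curve parameter t) is the trace on gamma ` {0<..<1}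
  of u \<in> W^1(V): limit in L2 of restrictions of approximants smooth near V \<union> curve
  which converge to u in W^1(V).\<close>
definition trace_rel :: "complex set \<Rightarrow> (real \<Rightarrow> complex) \<Rightarrow> (complex \<Rightarrow> real) \<Rightarrow> (real \<Rightarrow> real) \<Rightarrow> bool" where
  "trace_rel V \<gamma> u w \<longleftrightarrow> (\<exists>us w1 w2.
      L2 V u \<and> L2 V w1 \<and> L2 V w2 \<and> weak_deriv V 1 u w1 \<and> weak_deriv V \<i> u w2
      \<and> L2 {0<..<1} w
      \<and> (\<forall>n. \<exists>U. open U \<and> V \<union> \<gamma> ` {0<..<1} \<subseteq> U \<and> Cinf_on U (us n))
      \<and> (\<forall>n. L2 V (\<lambda>z. us n z - u z) \<and> L2 V (\<lambda>z. ddl [1] (us n) z - w1 z)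
             \<and> L2 V (\<lambda>z. ddl [\<i>] (us n) z - w2 z) \<and> L2 {0<..<1} (\<lambda>t. us n (\<gamma> t) - w t))
      \<and> (\<lambda>n. integral\<^sup>L (lebesgue_on V) (\<lambda>z. (us n z - u z)\<^sup>2)) \<longlonglongrightarrow> 0
      \<and> (\<lambda>n. integral\<^sup>L (lebesgue_on V) (\<lambda>z. (ddl [1] (us n) z - w1 z)\<^sup>2)) \<longlonglongrightarrow> 0
      \<and> (\<lambda>n. integral\<^sup>L (lebesgue_on V) (\<lambda>z. (ddl [\<i>] (us n) z - w2 z)\<^sup>2)) \<longlonglongrightarrow> 0
      \<and> (\<lambda>n. integral\<^sup>L (lebesgue_on {0<..<1}) (\<lambda>t. (us n (\<gamma> t) - w t)\<^sup>2)) \<longlonglongrightarrow> 0)"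

text \<open>Trace on the curve of the composite u \<circ> F, F defined on U: computed in some open V
  containing the curve with F ` V \<subseteq> G (the trace is local, so independent of V).\<close>
definition comp_trace_rel :: "complex set \<Rightarrow> complex set \<Rightarrow> (complex \<Rightarrow> complex) \<Rightarrow> (real \<Rightarrow> complex)
     \<Rightarrow> (complex \<Rightarrow> real) \<Rightarrow> (real \<Rightarrow> real) \<Rightarrow> bool" where
  "comp_trace_rel G U F \<gamma> u w \<longleftrightarrow> (\<exists>V. open V \<and> \<gamma> ` {0<..<1} \<subseteq> V \<and> V \<subseteq> U \<and> F ` V \<subseteq> G
      \<and> trace_rel V \<gamma> (u \<circ> F) w)"

definition halfplane :: "complex \<Rightarrow> complex \<Rightarrow> complex set" where
  "halfplane p n = {z. Re ((z - p) * cnj n) > 0}"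

definition example_setting ::
  "complex set \<Rightarrow> complex \<Rightarrow> complex \<Rightarrow> (real \<Rightarrow> complex) \<Rightarrow> (real \<Rightarrow> complex)
   \<Rightarrow> (complex \<Rightarrow> real) \<Rightarrow> (complex \<Rightarrow> real) \<Rightarrow> (complex \<Rightarrow> real)
   \<Rightarrow> complex set \<Rightarrow> (complex \<Rightarrow> complex) \<Rightarrow> complex set \<Rightarrow> (complex \<Rightarrow> complex)
   \<Rightarrow> complex set \<Rightarrow> (complex \<Rightarrow> complex) \<Rightarrow> bool" where
  "example_setting G g h \<gamma>1 \<gamma>2 b1 b2 a U1 \<Omega>1 U2 \<Omega>2 U \<Omega> \<longleftrightarrow>
     open G \<and> connected G \<and> bounded G \<and> G \<noteq> {}
   \<and> smooth_arc \<gamma>1 \<and> smooth_arc \<gamma>2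
   \<and> \<gamma>1 0 = g \<and> \<gamma>1 1 = h \<and> \<gamma>2 0 = g \<and> \<gamma>2 1 = h
   \<and> \<gamma>1 ` {0<..<1} \<inter> \<gamma>2 ` {0<..<1} = {}
   \<and> frontier G = \<gamma>1 ` {0<..<1} \<union> \<gamma>2 ` {0<..<1} \<union> {g, h}
   \<and> (\<forall>p\<in>{g, h}. \<exists>n e. n \<noteq> 0 \<and> e > 0 \<and> G \<inter> ball p e = halfplane p n \<inter> ball p e)
   \<and> Cinf_on UNIV b1 \<and> Cinf_on UNIV b2 \<and> Cinf_on UNIV a
   \<and> (\<forall>(\<gamma>, Ui, \<Omega>i) \<in> {(\<gamma>1, U1, \<Omega>1), (\<gamma>2, U2, \<Omega>2)}.
        Cinf_diffeo_on Ui \<Omega>i \<and> \<gamma> ` {0..1} \<subseteq> Ui \<and> \<Omega>i ` (\<gamma> ` {0<..<1}) \<subseteq> G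
        \<and> \<Omega>i g = g \<and> \<Omega>i h = h
        \<and> (\<forall>p\<in>{g, h}. \<exists>e>0. \<exists>\<sigma>\<in>{\<i>, -\<i>}. ball p e \<subseteq> Ui
              \<and> (\<forall>y\<in>ball p e. \<Omega>i y = p + \<sigma> * (y - p))))
   \<and> Cinf_diffeo_on U \<Omega> \<and> \<gamma>1 ` {0<..<1} \<subseteq> U \<and> \<Omega> ` (\<gamma>1 ` {0<..<1}) \<subseteq> G
   \<and> closure (\<Omega> ` (\<gamma>1 ` {0<..<1})) \<inter> {g, h} = {}"

definition gen_solution ::
  "complex set \<Rightarrow> (real \<Rightarrow> complex) \<Rightarrow> (real \<Rightarrow> complex)
   \<Rightarrow> (complex \<Rightarrow> real) \<Rightarrow> (complex \<Rightarrow> real) \<Rightarrow> (complex \<Rightarrow> real)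
   \<Rightarrow> complex set \<Rightarrow> (complex \<Rightarrow> complex) \<Rightarrow> complex set \<Rightarrow> (complex \<Rightarrow> complex)
   \<Rightarrow> complex set \<Rightarrow> (complex \<Rightarrow> complex)
   \<Rightarrow> (complex \<Rightarrow> real) \<Rightarrow> (complex \<Rightarrow> real) \<Rightarrow> (complex \<Rightarrow> real) \<Rightarrow> (complex \<Rightarrow> real) \<Rightarrow> bool" where
  "gen_solution G \<gamma>1 \<gamma>2 b1 b2 a U1 \<Omega>1 U2 \<Omega>2 U \<Omega> f0 f1 f2 u \<longleftrightarrow>
     W1 G u
   \<and> (\<forall>\<phi>. test_fn G \<phi> \<longrightarrow>
        integral\<^sup>L (lebesgue_on G) (\<lambda>z. u z * lap \<phi> z) = integral\<^sup>L (lebesgue_on G) (\<lambda>z. f0 z * \<phi> z))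
   \<and> (\<exists>w0 w1 w2. trace_rel G \<gamma>1 u w0 \<and> comp_trace_rel G U1 \<Omega>1 \<gamma>1 u w1
        \<and> comp_trace_rel G U \<Omega> \<gamma>1 u w2
        \<and> (AE t in lebesgue_on {0<..<1}. w0 t + b1 (\<gamma>1 t) * w1 t + a (\<gamma>1 t) * w2 t = f1 (\<gamma>1 t)))
   \<and> (\<exists>w0 w1. trace_rel G \<gamma>2 u w0 \<and> comp_trace_rel G U2 \<Omega>2 \<gamma>2 u w1
        \<and> (AE t in lebesgue_on {0<..<1}. w0 t + b2 (\<gamma>2 t) * w1 t = f2 (\<gamma>2 t)))"

end

theory Submission
  imports Defs
begin

text \<open>Let \<open>p\<close> be a corner with \<open>b1 p + b2 p \<in> (-2, 0)\<close> and \<open>\<zeta> = (z - p) / n\<close> the coordinate in which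
  \<open>G\<close> is the right half-plane near \<open>p\<close>. The model problem with coefficients frozen at \<open>p\<close> has the
  homogeneous solution \<open>Re \<zeta>\<^sup>\<mu> + E Im \<zeta>\<^sup>\<mu>\<close> of degree \<open>\<mu> \<in> (0, 1)\<close>, where \<open>2 cos (\<mu> \<pi> / 2) = - (b1 p + b2 p)\<close>;
  since \<open>\<mu> < 1\<close> it lies in \<open>W\<^sup>1\<close> but not in \<open>W\<^sup>2\<close>. To satisfy the conditions with variable coefficients exactly, let
  \<open>u = \<xi> (Re \<zeta>\<^sup>\<mu> + E1 Im \<zeta>\<^sup>\<mu> + E2 Im \<zeta> Im \<zeta>\<^sup>\<mu>\<^sup>-\<^sup>1)\<close> with a radial cutoff \<open>\<xi>\<close>: the last two terms vanish on
  the ray \<open>Im \<zeta> = 0\<close>, onto which both rotations map the boundary, and on \<open>\<zeta> = \<plusminus> i r\<close> they are an odd and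
  an even multiple of \<open>r\<^sup>\<mu>\<close>, so \<open>E1\<close>, \<open>E2\<close> can be solved for pointwise, with \<open>E2 p = 0\<close>.
  Then \<open>u\<close> differs from a harmonic homogeneous function by a term whose \<open>k\<close>-th derivatives are
  \<open>O(r\<^sup>\<mu>\<^sup>+\<^sup>1\<^sup>-\<^sup>k)\<close>; hence \<open>\<Delta>u \<in> L\<^sub>2\<close>, while the second derivatives of \<open>u\<close> grow like \<open>r\<^sup>\<mu>\<^sup>-\<^sup>2\<close> on a
  sector, which is detected by bumps of radius \<open>\<kappa>\<rho>\<close> at distance \<open>\<rho>\<close> from \<open>p\<close>, \<open>\<rho> \<rightarrow> 0\<close>. Since \<open>p\<close> does not
  lie on the open curves, \<open>u\<close> is smooth near them and the traces are plain restrictions.\<close>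

section \<open>Iterated directional derivatives\<close>

lemma ddl_append: "ddl (vs @ ws) f = ddl vs (ddl ws f)"
  by (induction vs) auto

text \<open>\<open>frechet_derivative\<close> is a choice from the predicate
  \<open>has_derivative\<close>, and at \<open>z\<close> that predicate is the same for both
  functions; so the chosen maps agree, also at points where no derivative exists.\<close>

lemma frechet_derivative_cong_open:
  assumes "open S" "z \<in> S" "\<And>x. x \<in> S \<Longrightarrow> f x = g x"
  shows "frechet_derivative f (at z) = frechet_derivative g (at z)"
proof -
  have "(f has_derivative D) (at z) \<longleftrightarrow> (g has_derivative D) (at z)" for D
    using assms by (metis has_derivative_transform_within_open)
  then show ?thesis by (simp add: frechet_derivative_def)
qed

lemma ddl_cong:
  assumes "open S" "\<And>x. x \<in> S \<Longrightarrow> f x = g x" "z \<in> S"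
  shows "ddl vs f z = ddl vs g z"
  using assms(3)
proof (induction vs arbitrary: z)
  case (Cons v vs)
  then show ?case
    using frechet_derivative_cong_open[OF assms(1) Cons.prems, of "ddl vs f" "ddl vs g"] by simp
qed (use assms in auto)

lemma differentiable_on_cong_open:
  assumes "open S" "\<And>x. x \<in> S \<Longrightarrow> f x = g x" "f differentiable_on S"
  shows "g differentiable_on S"
  using assms has_derivative_transform_within_open[of f _ _ UNIV S g]
  unfolding differentiable_on_eq_differentiable_at[OF assms(1)] differentiable_def by blast

lemma ddl1: "(f has_derivative D) (at z) \<Longrightarrow> ddl [v] f z = D v"
  using frechet_derivative_at by fastforce

lemma has_derivative_ddl1:
  "f differentiable (at z) \<Longrightarrow> (f has_derivative (\<lambda>v. ddl [v] f z)) (at z)"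
  by (simp add: frechet_derivative_works)

lemma differentiable_at_open:
  "open S \<Longrightarrow> f differentiable_on S \<Longrightarrow> z \<in> S \<Longrightarrow> f differentiable (at z)"
  by (simp add: differentiable_on_eq_differentiable_at)

text \<open>\<open>B a\<close> is a class of functions of weight \<open>a\<close>, and every derivative lowers the weight by one. With
  \<open>B\<close> trivial this is plain \<open>k\<close>-fold differentiability; with \<open>B a\<close> the functions \<open>O(r\<^sup>a)\<close> it yields the
  symbol estimates at the corner.\<close>

definition Ck :: "(real \<Rightarrow> ('a::real_normed_vector \<Rightarrow> real) \<Rightarrow> bool) \<Rightarrow> 'a set \<Rightarrow> nat \<Rightarrow> real \<Rightarrow> ('a \<Rightarrow> real) \<Rightarrow> bool"
  where "Ck B S k a f \<longleftrightarrow> (\<forall>vs. length vs \<le> k \<longrightarrow>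
     ddl vs f differentiable_on S \<and> B (a - length vs) (ddl vs f))"

lemma Ck_0: "Ck B S 0 a f \<longleftrightarrow> f differentiable_on S \<and> B a f"
  by (auto simp: Ck_def)

text \<open>Splits off the innermost derivative, which is the last entry of the list. The inductions
  below then apply their hypothesis to \<open>ddl [v] f\<close> in place of
  \<open>f\<close>.\<close>

lemma Ck_Suc:
  "Ck B S (Suc k) a f \<longleftrightarrow> f differentiable_on S \<and> B a f \<and> (\<forall>v. Ck B S k (a - 1) (ddl [v] f))"
proof (intro iffI conjI allI)
  assume L: "Ck B S (Suc k) a f"
  from L show "f differentiable_on S" "B a f"
    unfolding Ck_def by (metis ddl.simps(1) list.size(3) zero_le diff_zero of_nat_0)+
  show "Ck B S k (a - 1) (ddl [v] f)" for v
    unfolding Ck_def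
  proof (intro allI impI)
    fix vs :: "'a list" assume "length vs \<le> k"
    then have "length (vs @ [v]) \<le> Suc k" by simp
    with L have "ddl (vs @ [v]) f differentiable_on S \<and> B (a - length (vs @ [v])) (ddl (vs @ [v]) f)"
      unfolding Ck_def by blast
    then show "ddl vs (ddl [v] f) differentiable_on S \<and> B (a - 1 - length vs) (ddl vs (ddl [v] f))"
      by (simp only: ddl_append) (simp add: algebra_simps)
  qed
next
  assume R: "f differentiable_on S \<and> B a f \<and> (\<forall>v. Ck B S k (a - 1) (ddl [v] f))"
  show "Ck B S (Suc k) a f"
    unfolding Ck_def
  proof (intro allI impI)
    fix vs :: "'a list" assume l: "length vs \<le> Suc k"
    show "ddl vs f differentiable_on S \<and> B (a - length vs) (ddl vs f)"
    proof (cases vs rule: rev_cases)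
      case Nil
      then show ?thesis using R by simp
    next
      case (snoc ws v)
      with l have "length ws \<le> k" by simp
      with R have "ddl ws (ddl [v] f) differentiable_on S \<and> B (a - 1 - length ws) (ddl ws (ddl [v] f))"
        unfolding Ck_def by blast
      then show ?thesis
        unfolding snoc by (simp only: ddl_append) (simp add: algebra_simps)
    qed
  qed
qed

lemma Ck_mono_k: "Ck B S k a f \<Longrightarrow> j \<le> k \<Longrightarrow> Ck B S j a f"
  by (auto simp: Ck_def)

text \<open>The closure properties that the sum and Leibniz rules consume: weights add under
  products, so both terms of the derivative of a product have weight
  \<open>a + b - 1\<close>.\<close>

locale graded =
  fixes S :: "'a::real_normed_vector set" and B :: "real \<Rightarrow> ('a \<Rightarrow> real) \<Rightarrow> bool"
  assumes S: "open S"
    and B_cong: "\<And>a f g. (\<And>z. z \<in> S \<Longrightarrow> f z = g z) \<Longrightarrow> B a f \<Longrightarrow> B a g"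
    and B_add: "\<And>a f g. B a f \<Longrightarrow> B a g \<Longrightarrow> B a (\<lambda>z. f z + g z)"
    and B_mult: "\<And>a b f g. B a f \<Longrightarrow> B b g \<Longrightarrow> B (a + b) (\<lambda>z. f z * g z)"
begin

lemma Ck_cong:
  assumes "\<And>z. z \<in> S \<Longrightarrow> f z = g z" "Ck B S k a f"
  shows "Ck B S k a g"
  unfolding Ck_def
proof (intro allI impI)
  fix vs :: "'a list" assume "length vs \<le> k"
  have c: "ddl vs f z = ddl vs g z" if "z \<in> S" for z
    by (rule ddl_cong[OF S _ that]) (rule assms(1))
  from \<open>length vs \<le> k\<close> have "ddl vs f differentiable_on S" "B (a - length vs) (ddl vs f)"
    using assms(2) by (auto simp: Ck_def)
  then show "ddl vs g differentiable_on S \<and> B (a - length vs) (ddl vs g)"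
    using differentiable_on_cong_open[OF S, of "ddl vs f" "ddl vs g"] B_cong[of "ddl vs f" "ddl vs g"] c
    by blast
qed

lemma Ck_add:
  "Ck B S k a f \<Longrightarrow> Ck B S k a g \<Longrightarrow> Ck B S k a (\<lambda>z. f z + g z)"
proof (induction k arbitrary: a f g)
  case 0
  then show ?case by (auto simp: Ck_0 intro: B_add)
next
  case (Suc k)
  have d: "f differentiable_on S" "g differentiable_on S" using Suc.prems by (auto simp: Ck_Suc)
  have "Ck B S k (a - 1) (ddl [v] (\<lambda>z. f z + g z))" for v
  proof (rule Ck_cong)
    show "Ck B S k (a - 1) (\<lambda>z. ddl [v] f z + ddl [v] g z)"
      using Suc by (auto simp: Ck_Suc)
    show "ddl [v] f z + ddl [v] g z = ddl [v] (\<lambda>z. f z + g z) z" if "z \<in> S" for z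
      by (rule ddl1[symmetric])
        (intro has_derivative_add has_derivative_ddl1 differentiable_at_open[OF S _ that] d)
  qed
  then show ?case using Suc.prems d by (auto simp: Ck_Suc intro: B_add)
qed

lemma Ck_mult:
  "Ck B S k a f \<Longrightarrow> Ck B S k b g \<Longrightarrow> Ck B S k (a + b) (\<lambda>z. f z * g z)"
proof (induction k arbitrary: a b f g)
  case 0
  then show ?case by (auto simp: Ck_0 intro: B_mult)
next
  case (Suc k)
  have d: "f differentiable_on S" "g differentiable_on S" using Suc.prems by (auto simp: Ck_Suc)
  have m: "Ck B S k a f" "Ck B S k b g" using Suc.prems by (auto intro: Ck_mono_k)
  have "Ck B S k (a + b - 1) (ddl [v] (\<lambda>z. f z * g z))" for v
  proof (rule Ck_cong)
    have "Ck B S k (a + (b - 1)) (\<lambda>z. f z * ddl [v] g z)"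
      by (rule Suc.IH[OF m(1)]) (use Suc.prems in \<open>simp add: Ck_Suc\<close>)
    moreover have "Ck B S k ((a - 1) + b) (\<lambda>z. ddl [v] f z * g z)"
      by (rule Suc.IH[OF _ m(2)]) (use Suc.prems in \<open>simp add: Ck_Suc\<close>)
    ultimately show "Ck B S k (a + b - 1) (\<lambda>z. f z * ddl [v] g z + ddl [v] f z * g z)"
      by (intro Ck_add) (simp_all add: algebra_simps)
    show "f z * ddl [v] g z + ddl [v] f z * g z = ddl [v] (\<lambda>z. f z * g z) z" if "z \<in> S" for z
      by (rule ddl1[symmetric])
        (intro has_derivative_mult has_derivative_ddl1 differentiable_at_open[OF S _ that] d)
  qed
  then show ?case using Suc.prems d by (auto simp: Ck_Suc intro: B_mult)
qed

end

section \<open>Calculus of smooth functions\<close>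

lemma Cinf_on_iff_Ck: "Cinf_on S f \<longleftrightarrow> (\<forall>k. Ck (\<lambda>_ _. True) S k a f)"
  by (auto simp: Cinf_on_def Ck_def)

lemma graded_True: "open S \<Longrightarrow> graded S (\<lambda>_ _. True)"
  by unfold_locales auto

lemma Cinf_on_add:
  fixes f g :: "'a::real_normed_vector \<Rightarrow> real"
  shows "open S \<Longrightarrow> Cinf_on S f \<Longrightarrow> Cinf_on S g \<Longrightarrow> Cinf_on S (\<lambda>z. f z + g z)"
  using graded.Ck_add[OF graded_True] unfolding Cinf_on_iff_Ck[where a=0] by blast

lemma Cinf_on_mult:
  fixes f g :: "'a::real_normed_vector \<Rightarrow> real"
  shows "open S \<Longrightarrow> Cinf_on S f \<Longrightarrow> Cinf_on S g \<Longrightarrow> Cinf_on S (\<lambda>z. f z * g z)"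
  using graded.Ck_mult[OF graded_True, of S _ 0 f 0 g] unfolding Cinf_on_iff_Ck[where a=0] by auto

lemma Cinf_on_cong:
  assumes "open S" "\<And>z. z \<in> S \<Longrightarrow> f z = g z" "Cinf_on S f"
  shows "Cinf_on S g"
  unfolding Cinf_on_def
proof
  fix vs
  have c: "ddl vs f z = ddl vs g z" if "z \<in> S" for z
    by (rule ddl_cong[OF assms(1) _ that]) (rule assms(2))
  show "ddl vs g differentiable_on S"
    using assms(3) by (intro differentiable_on_cong_open[OF assms(1) c]) (auto simp: Cinf_on_def)
qed

lemma Cinf_on_ddl: "Cinf_on S f \<Longrightarrow> Cinf_on S (ddl vs f)"
  unfolding Cinf_on_def by (metis ddl_append)

lemma Cinf_on_subset: "Cinf_on S f \<Longrightarrow> T \<subseteq> S \<Longrightarrow> Cinf_on T f"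
  unfolding Cinf_on_def by (meson differentiable_on_subset)

lemma Cinf_on_Un: "open S \<Longrightarrow> open T \<Longrightarrow> Cinf_on S f \<Longrightarrow> Cinf_on T f \<Longrightarrow> Cinf_on (S \<union> T) f"
  unfolding Cinf_on_def by (auto simp: differentiable_on_eq_differentiable_at open_Un)

lemma Cinf_on_differentiable_at:
  "open S \<Longrightarrow> Cinf_on S f \<Longrightarrow> z \<in> S \<Longrightarrow> ddl vs f differentiable (at z)"
  unfolding Cinf_on_def using differentiable_at_open by blast

lemma Cinf_on_continuous: "Cinf_on S f \<Longrightarrow> continuous_on S (ddl vs f)"
  unfolding Cinf_on_def using differentiable_imp_continuous_on by blast

lemma Cinf_on_const: "Cinf_on S (\<lambda>_. c)"
proof -
  have "\<exists>d. ddl vs (\<lambda>_. c) = (\<lambda>_. d)" for vs :: "'a list"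
    by (induction vs) auto
  then show ?thesis unfolding Cinf_on_def by (metis differentiable_on_const)
qed

text \<open>The derivative of the inner map is constantly \<open>L\<close>, so each differentiation
  only feeds its direction through \<open>L\<close> and no further chain-rule terms arise.\<close>

lemma ddl_affine:
  fixes f :: "'b::real_normed_vector \<Rightarrow> 'c::real_normed_vector" and L :: "'a::real_normed_vector \<Rightarrow> 'b"
  assumes "open S" "Cinf_on S f" "bounded_linear L" "q + L z \<in> S"
  shows "ddl vs (\<lambda>z. f (q + L z)) z = ddl (map L vs) f (q + L z)"
  using assms(4)
proof (induction vs arbitrary: z)
  case (Cons v vs)
  let ?T = "(\<lambda>z. q + L z) -` S"
  have T: "open ?T"
    by (intro open_vimage assms continuous_intros linear_continuous_on)
  have "ddl (v # vs) (\<lambda>z. f (q + L z)) z = frechet_derivative (\<lambda>z. ddl (map L vs) f (q + L z)) (at z) v"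
    unfolding ddl.simps
    by (rule fun_cong, rule frechet_derivative_cong_open[OF T]) (use Cons in auto)
  also have "\<dots> = frechet_derivative (ddl (map L vs) f) (at (q + L z)) (L v)"
  proof (rule ddl1[unfolded ddl.simps])
    have "((\<lambda>z. q + L z) has_derivative L) (at z)"
      using has_derivative_add[OF has_derivative_const bounded_linear_imp_has_derivative[OF assms(3)]] by simp
    then show "((\<lambda>z. ddl (map L vs) f (q + L z)) has_derivative
        (\<lambda>v. frechet_derivative (ddl (map L vs) f) (at (q + L z)) (L v))) (at z)"
      by (rule has_derivative_compose)
        (use Cinf_on_differentiable_at[OF assms(1,2) Cons.prems] frechet_derivative_works in blast)
  qed
  finally show ?case by simp
qed auto

lemma Cinf_on_affine:
  fixes f :: "'b::real_normed_vector \<Rightarrow> 'c::real_normed_vector" and L :: "'a::real_normed_vector \<Rightarrow> 'b"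
  assumes "open S" "Cinf_on S f" "bounded_linear L"
  shows "Cinf_on ((\<lambda>z. q + L z) -` S) (\<lambda>z. f (q + L z))"
proof -
  let ?T = "(\<lambda>z. q + L z) -` S"
  have T: "open ?T"
    by (intro open_vimage assms continuous_intros linear_continuous_on)
  show ?thesis unfolding Cinf_on_def
  proof
    fix vs
    have "(\<lambda>z. ddl (map L vs) f (q + L z)) differentiable_on ?T"
      unfolding differentiable_on_eq_differentiable_at[OF T]
    proof
      fix z assume "z \<in> ?T"
      then have "ddl (map L vs) f differentiable (at (q + L z))"
        using Cinf_on_differentiable_at[OF assms(1,2)] by simp
      moreover have "(\<lambda>z. q + L z) differentiable (at z)"
        using assms(3) bounded_linear_imp_differentiable by (intro differentiable_add) auto
      ultimately show "(\<lambda>z. ddl (map L vs) f (q + L z)) differentiable at z"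
        using differentiable_chain_at[of "\<lambda>z. q + L z"] by (simp add: o_def)
    qed
    then show "ddl vs (\<lambda>z. f (q + L z)) differentiable_on ?T"
      by (rule differentiable_on_cong_open[OF T, rotated]) (simp add: ddl_affine[OF assms])
  qed
qed

lemma Cinf_on_linear:
  assumes "bounded_linear L" shows "Cinf_on S L"
  unfolding Cinf_on_def
proof
  fix vs
  have "L differentiable_on S"
    using assms by (simp add: bounded_linear_imp_differentiable_on)
  moreover have "ddl (vs @ [v]) L = ddl vs (\<lambda>_. L v)" for vs v
    unfolding ddl_append using frechet_derivative_at[OF bounded_linear_imp_has_derivative[OF assms]]
    by (metis ddl.simps)
  ultimately show "ddl vs L differentiable_on S"
    using Cinf_on_const[unfolded Cinf_on_def, rule_format] by (cases vs rule: rev_cases) simp_all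
qed

text \<open>Induction on the order over all smooth \<open>F\<close> at once: the derivative in
  direction \<open>v\<close> is \<open>ddl [1] F\<close> composed with \<open>f\<close>, covered by
  the induction hypothesis, times \<open>ddl [v] f\<close>.\<close>

lemma Cinf_on_compose_real:
  fixes f :: "'a::real_normed_vector \<Rightarrow> real" and F :: "real \<Rightarrow> real"
  assumes "open S" "Cinf_on S f" "Cinf_on UNIV F"
  shows "Cinf_on S (\<lambda>z. F (f z))"
proof -
  let ?D = "Ck (\<lambda>_ _. True) S"
  interpret graded S "\<lambda>_ _. True" by (rule graded_True) fact
  have d: "f differentiable (at z)" if "z \<in> S" for z
    using Cinf_on_differentiable_at[OF assms(1,2) that, of "[]"] by simp
  have dF: "F differentiable (at x)" if "Cinf_on UNIV F" for F x
    using Cinf_on_differentiable_at[OF open_UNIV that, of _ "[]"] by simp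
  have diff: "(\<lambda>z. F (f z)) differentiable_on S" if "Cinf_on UNIV F" for F
    unfolding differentiable_on_eq_differentiable_at[OF assms(1)]
    using differentiable_chain_at[OF d dF[OF that]] by (simp add: o_def)
  have "?D k 0 (\<lambda>z. F (f z))" for k
    using assms(3)
  proof (induction k arbitrary: F)
    case 0
    then show ?case using diff by (simp add: Ck_0)
  next
    case (Suc k)
    have "?D k (- 1) (ddl [v] (\<lambda>z. F (f z)))" for v
    proof (rule Ck_cong)
      have "?D k (-1) (ddl [v] f)"
        using Cinf_on_ddl[OF assms(2), of "[v]"] unfolding Cinf_on_iff_Ck[where a="-1"] by blast
      moreover have "?D k 0 (\<lambda>z. ddl [1] F (f z))"
        by (intro Suc.IH Cinf_on_ddl Suc.prems)
      ultimately show "?D k (-1) (\<lambda>z. ddl [1] F (f z) * ddl [v] f z)"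
        using Ck_mult[of k 0 _ "-1"] by auto
      fix z assume z: "z \<in> S"
      have "((\<lambda>z. F (f z)) has_derivative (\<lambda>v. ddl [ddl [v] f z] F (f z))) (at z)"
        by (rule has_derivative_compose[OF has_derivative_ddl1[OF d[OF z]]])
          (rule has_derivative_ddl1[OF dF[OF Suc.prems]])
      then have "ddl [v] (\<lambda>z. F (f z)) z = ddl [ddl [v] f z] F (f z)"
        by (rule ddl1)
      also have "\<dots> = ddl [1] F (f z) * ddl [v] f z"
        using has_derivative_linear[OF has_derivative_ddl1[OF dF[OF Suc.prems, of "f z"]]]
        using linear_scale[of "\<lambda>v. ddl [v] F (f z)" "ddl [v] f z" 1] by (simp add: mult.commute)
      finally show "ddl [1] F (f z) * ddl [v] f z = ddl [v] (\<lambda>z. F (f z)) z" ..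
    qed
    then show ?case using diff[OF Suc.prems] by (simp add: Ck_Suc)
  qed
  then show ?thesis unfolding Cinf_on_iff_Ck[where a=0] by blast
qed

section \<open>Bump functions and weak derivatives\<close>

definition flat :: "real poly \<Rightarrow> real \<Rightarrow> real" where
  "flat p x = (if x > 0 then poly p (1 / x) * exp (- (1 / x)) else 0)"

lemma tendsto_poly_div_exp: "((\<lambda>t::real. poly p t / exp t) \<longlongrightarrow> 0) at_top"
proof -
  have "((\<lambda>t::real. \<Sum>i\<le>degree p. coeff p i * (t ^ i / exp t)) \<longlongrightarrow> (\<Sum>i\<le>degree p. coeff p i * 0)) at_top"
    by (intro tendsto_intros tendsto_power_div_exp_0)
  then show ?thesis by (simp add: poly_altdef sum_divide_distrib)
qed

text \<open>The family \<open>flat\<close> is closed under differentiation: with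
  \<open>t = 1/x\<close>, the \<open>x\<close>-derivative of \<open>p(t) exp(-t)\<close> is
  \<open>t^2 (p - p')(t) exp(-t)\<close>. One first-order statement thus yields derivatives of all
  orders.\<close>

lemma flat_has_derivative:
  "(flat p has_real_derivative flat ([:0, 0, 1:] * (p - pderiv p)) x) (at x)"
proof -
  consider "x > 0" | "x < 0" | "x = 0" by linarith
  then show ?thesis
  proof cases
    case 1
    have "((\<lambda>x. poly p (1 / x) * exp (- (1 / x))) has_real_derivative
        flat ([:0, 0, 1:] * (p - pderiv p)) x) (at x)"
      using 1 by (auto intro!: derivative_eq_intros DERIV_chain2[OF poly_DERIV]
          simp: flat_def field_simps power2_eq_square)
    then show ?thesis
      by (rule has_field_derivative_transform_within_open[where S="{0<..}"]) (use 1 in \<open>auto simp: flat_def\<close>)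
  next
    case 2
    have "((\<lambda>x. 0) has_real_derivative flat ([:0, 0, 1:] * (p - pderiv p)) x) (at x)"
      using 2 by (simp add: flat_def)
    then show ?thesis
      by (rule has_field_derivative_transform_within_open[where S="{..<0}"]) (use 2 in \<open>auto simp: flat_def\<close>)
  next
    case 3
    \<comment> \<open>With \<open>t = 1/y\<close> the difference quotient from the right is
      \<open>t p(t) / exp t\<close>, whence the polynomial \<open>pCons 0 p\<close>.\<close>
    have "((\<lambda>y. flat p y / y) \<longlongrightarrow> 0) (at_right 0)"
    proof (rule tendsto_cong[THEN iffD1])
      show "((\<lambda>y. poly (pCons 0 p) (inverse y) / exp (inverse y)) \<longlongrightarrow> 0) (at_right (0::real))"
        by (rule filterlim_compose[OF tendsto_poly_div_exp filterlim_inverse_at_top_right])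
      show "\<forall>\<^sub>F y in at_right 0. poly (pCons 0 p) (inverse y) / exp (inverse y) = flat p y / y"
        unfolding eventually_at_right_field
        by (rule exI[of _ 1]) (auto simp: flat_def exp_minus field_simps)
    qed
    moreover have "((\<lambda>y. flat p y / y) \<longlongrightarrow> 0) (at_left 0)"
      by (rule tendsto_cong[THEN iffD1, of "\<lambda>_. 0"])
        (auto simp: eventually_at_left_field flat_def intro: exI[of _ "-1"])
    ultimately show ?thesis
      using 3 by (simp add: has_field_derivative_iff filterlim_split_at flat_def[of _ 0])
  qed
qed

lemma Cinf_on_flat: "Cinf_on S (flat p)"
proof -
  have d: "(flat p has_derivative (\<lambda>v. flat ([:0, 0, 1:] * (p - pderiv p)) x * v)) (at x)" for p x
    using flat_has_derivative[of p x] by (simp add: has_field_derivative_def)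
  have "\<exists>q. ddl vs (flat p) = flat q" for vs
  proof (induction vs)
    case (Cons v vs)
    then obtain q where q: "ddl vs (flat p) = flat q" by blast
    have "ddl (v # vs) (flat p) = flat (smult v ([:0, 0, 1:] * (q - pderiv q)))"
      using ddl1[OF d, of v q] by (auto simp: q flat_def algebra_simps)
    then show ?case by blast
  qed auto
  moreover have "flat p differentiable_on S" for p
    using d by (meson differentiable_at_imp_differentiable_on differentiable_def)
  ultimately show ?thesis unfolding Cinf_on_def by metis
qed

text \<open>The squared norm is a polynomial in the coordinates, so smoothness survives at the
  centre. Dependence on the distance alone makes the bump invariant under rotations about
  \<open>z0\<close>.\<close>

definition bump :: "complex \<Rightarrow> real \<Rightarrow> complex \<Rightarrow> real" where
  "bump z0 r z = flat 1 (1 - (norm (z - z0) / r)\<^sup>2)"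

lemma Cinf_on_Re_Im: "Cinf_on S (\<lambda>z. Re (z - z0))" "Cinf_on S (\<lambda>z. Im (z - z0))"
proof -
  have "Cinf_on UNIV (\<lambda>z. - Re z0 + Re z)" "Cinf_on UNIV (\<lambda>z. - Im z0 + Im z)"
    by (intro Cinf_on_add Cinf_on_const Cinf_on_linear bounded_linear_Re bounded_linear_Im open_UNIV)+
  then show "Cinf_on S (\<lambda>z. Re (z - z0))" "Cinf_on S (\<lambda>z. Im (z - z0))"
    by (auto intro: Cinf_on_subset)
qed

lemma Cinf_on_bump: "Cinf_on S (bump z0 r)"
proof -
  have "Cinf_on UNIV (\<lambda>z. 1 + (- (1 / r\<^sup>2)) * (Re (z - z0) * Re (z - z0) + Im (z - z0) * Im (z - z0)))"
    by (intro Cinf_on_add Cinf_on_mult Cinf_on_const Cinf_on_Re_Im open_UNIV)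
  then have "Cinf_on UNIV (\<lambda>z. flat 1 (1 + (- (1 / r\<^sup>2)) * (Re (z - z0) * Re (z - z0) + Im (z - z0) * Im (z - z0))))"
    by (rule Cinf_on_compose_real[OF open_UNIV _ Cinf_on_flat])
  also have "(\<lambda>z. flat 1 (1 + (- (1 / r\<^sup>2)) * (Re (z - z0) * Re (z - z0) + Im (z - z0) * Im (z - z0)))) = bump z0 r"
    by (simp add: bump_def fun_eq_iff power_divide cmod_power2 flip: power2_eq_square)
  finally show ?thesis by (rule Cinf_on_subset) simp
qed

lemma bump_bounds: "0 \<le> bump z0 r z" "bump z0 r z \<le> 1"
  by (auto simp: bump_def flat_def)

lemma bump_eq_0_iff: "r > 0 \<Longrightarrow> bump z0 r z = 0 \<longleftrightarrow> r \<le> norm (z - z0)"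
proof -
  assume "r > 0"
  have "1 \<le> (norm (z - z0) / r)\<^sup>2 \<longleftrightarrow> 1 \<le> norm (z - z0) / r"
    using \<open>r > 0\<close> power2_le_iff_abs_le[of "norm (z - z0) / r" 1] abs_le_square_iff[of 1 "norm (z - z0) / r"]
    by simp
  then show ?thesis using \<open>r > 0\<close> by (auto simp: bump_def flat_def not_less)
qed

text \<open>On the disc of half the radius the argument of \<open>flat 1\<close> is at least
  \<open>1 - 1/4\<close>.\<close>

lemma bump_ge:
  assumes "r > 0" "norm (z - z0) \<le> r / 2" shows "flat 1 (3/4) \<le> bump z0 r z"
proof -
  have "(norm (z - z0) / r)\<^sup>2 \<le> (1/2)\<^sup>2"
    using assms by (intro power_mono) (auto simp: field_simps)
  then have "3/4 \<le> 1 - (norm (z - z0) / r)\<^sup>2" by (simp add: power2_eq_square)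
  moreover from this have "1 / (1 - (norm (z - z0) / r)\<^sup>2) \<le> 1 / (3/4)"
    by (intro divide_left_mono) auto
  ultimately show ?thesis by (simp add: bump_def flat_def)
qed

lemma test_fn_bump:
  assumes "r > 0" "cball z0 r \<subseteq> G" shows "test_fn G (bump z0 r)"
proof -
  have "closure {z. bump z0 r z \<noteq> 0} \<subseteq> cball z0 r"
    using assms(1) by (intro closure_minimal) (auto simp: bump_eq_0_iff dist_norm norm_minus_commute)
  then show ?thesis
    using assms(2) Cinf_on_bump bounded_subset[OF bounded_cball]
    unfolding test_fn_def compact_eq_bounded_closed by blast
qed

lemma ddl_zero: "ddl vs (\<lambda>_. 0) = (\<lambda>_. 0)"
  by (induction vs) auto

lemma ddl_outside_support:
  assumes "z \<notin> closure {z. \<phi> z \<noteq> 0}" shows "ddl vs \<phi> z = 0"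
proof -
  have "ddl vs \<phi> z = ddl vs (\<lambda>_. 0) z"
    by (rule ddl_cong[of "- closure {z. \<phi> z \<noteq> 0}"])
      (use assms closure_subset[of "{z. \<phi> z \<noteq> 0}"] in auto)
  then show ?thesis by (simp add: ddl_zero)
qed

lemma test_fn_ddl:
  assumes "test_fn G \<phi>" shows "test_fn G (ddl vs \<phi>)"
proof -
  have "closure {z. ddl vs \<phi> z \<noteq> 0} \<subseteq> closure {z. \<phi> z \<noteq> 0}"
    by (intro closure_minimal) (use ddl_outside_support in blast, simp)
  then show ?thesis
    using assms Cinf_on_ddl[of UNIV \<phi>] bounded_subset[of "closure {z. \<phi> z \<noteq> 0}"]
    unfolding test_fn_def compact_eq_bounded_closed by blast
qed

section \<open>Integration by parts against test functions\<close>

lemma integrable_compact_support: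
  fixes F :: "'a::euclidean_space \<Rightarrow> real"
  assumes "continuous_on UNIV F" "compact K" "\<And>z. z \<notin> K \<Longrightarrow> F z = 0"
  shows "integrable lborel F"
proof -
  have "integrable lborel (\<lambda>x. indicator K x *\<^sub>R F x)"
    using assms by (intro borel_integrable_compact) (auto intro: continuous_on_subset)
  also have "(\<lambda>x. indicator K x *\<^sub>R F x) = F"
    using assms(3) by (auto simp: indicator_def fun_eq_iff)
  finally show ?thesis .
qed

text \<open>Translation invariance makes the integrals of the difference quotients of \<open>F\<close> vanish.\<close>

lemma integral_ddl_compact_support:
  fixes F :: "'a::euclidean_space \<Rightarrow> real"
  assumes F: "Cinf_on UNIV F" and K: "compact K" "\<And>z. z \<notin> K \<Longrightarrow> F z = 0"
  shows "integral\<^sup>L lborel (ddl [v] F) = 0"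
proof -
  define Q where "Q = (\<lambda>n z. real (Suc n) * (F (z + v /\<^sub>R real (Suc n)) - F z))"
  have dF: "(F has_derivative (\<lambda>v. ddl [v] F z)) (at z)" for z
    using Cinf_on_differentiable_at[OF open_UNIV F, of z "[]"] by (intro has_derivative_ddl1) simp
  have cF: "continuous_on UNIV F" and cD: "continuous_on UNIV (ddl [v] F)"
    using Cinf_on_continuous[OF F, of "[]"] Cinf_on_continuous[OF F, of "[v]"] by auto
  have F0: "ddl [v] F z = 0" if "z \<notin> K" for z
  proof (rule ddl_outside_support)
    have "closure {z. F z \<noteq> 0} \<subseteq> K"
      using K compact_imp_closed by (intro closure_minimal) auto
    then show "z \<notin> closure {z. F z \<noteq> 0}" using that by blast
  qed
  have "bounded (ddl [v] F ` K)"
    using cD K(1) by (meson compact_continuous_image compact_imp_bounded continuous_on_subset subset_UNIV)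
  then obtain M where M: "\<And>z. z \<in> K \<Longrightarrow> \<bar>ddl [v] F z\<bar> \<le> M" "M > 0"
    unfolding bounded_pos by auto
  then have M': "\<bar>ddl [v] F z\<bar> \<le> M" for z
    using F0[of z] by (cases "z \<in> K") auto
  obtain R where R: "\<And>z. z \<in> K \<Longrightarrow> norm z \<le> R"
    using compact_imp_bounded[OF K(1)] unfolding bounded_iff by auto
  have intF: "integrable lborel (\<lambda>z. F (z + w))" "integral\<^sup>L lborel (\<lambda>z. F (z + w)) = integral\<^sup>L lborel F" for w
  proof -
    have "integrable (distr lborel borel ((+) w)) F"
      unfolding lborel_distr_plus by (rule integrable_compact_support[OF cF K])
    then show "integrable lborel (\<lambda>z. F (z + w))"
      by (subst (asm) integrable_distr_eq)
        (use cF in \<open>auto simp: add.commute borel_measurable_continuous_onI\<close>)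
    have "integral\<^sup>L lborel F = integral\<^sup>L (distr lborel borel ((+) w)) F"
      by (simp add: lborel_distr_plus)
    also have "\<dots> = integral\<^sup>L lborel (\<lambda>z. F (z + w))"
      by (subst integral_distr) (use cF in \<open>auto simp: add.commute borel_measurable_continuous_onI\<close>)
    finally show "integral\<^sup>L lborel (\<lambda>z. F (z + w)) = integral\<^sup>L lborel F" ..
  qed
  have Q0: "integral\<^sup>L lborel (Q n) = 0" for n
    unfolding Q_def using intF[of "v /\<^sub>R real (Suc n)"] intF[of 0] by simp
  have lim: "(\<lambda>n. Q n z) \<longlonglongrightarrow> ddl [v] F z" for z
  proof -
    have "((\<lambda>t. F (z + t *\<^sub>R v)) has_derivative (\<lambda>t. ddl [t *\<^sub>R v] F z)) (at 0)"
      by (rule has_derivative_compose[of "\<lambda>t. z + t *\<^sub>R v" "\<lambda>t. t *\<^sub>R v"])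
        (auto intro!: derivative_eq_intros dF[simplified])
    moreover have "ddl [t *\<^sub>R v] F z = ddl [v] F z * t" for t
      using linear_scale[OF has_derivative_linear[OF dF[of z]], of t v] by (simp add: mult.commute)
    ultimately have "((\<lambda>t. F (z + t *\<^sub>R v)) has_real_derivative ddl [v] F z) (at 0)"
      by (simp add: has_field_derivative_def)
    then have "((\<lambda>t. (F (z + t *\<^sub>R v) - F z) / t) \<longlongrightarrow> ddl [v] F z) (at 0)"
      by (simp add: has_field_derivative_iff)
    then have "(\<lambda>n. (F (z + inverse (real (Suc n)) *\<^sub>R v) - F z) / inverse (real (Suc n))) \<longlonglongrightarrow> ddl [v] F z"
      by (rule filterlim_compose)
        (use LIMSEQ_inverse_real_of_nat in \<open>auto simp: filterlim_at\<close>)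
    then show ?thesis by (simp add: Q_def field_simps)
  qed
  \<comment> \<open>The mean value theorem bounds every quotient by \<open>M\<close>, and steps of
    length at most \<open>norm v\<close> keep all supports in one ball; this is the majorant for
    dominated convergence.\<close>
  have bound: "norm (Q n z) \<le> M * indicator (cball 0 (R + norm v)) z" for n z
  proof -
    define h where "h = 1 / real (Suc n)"
    have h: "0 < h" "h \<le> 1" by (auto simp: h_def)
    have hv: "v /\<^sub>R real (Suc n) = h *\<^sub>R v" by (simp add: h_def inverse_eq_divide)
    have der: "((\<lambda>t. F (z + t *\<^sub>R v)) has_real_derivative ddl [v] F (z + t *\<^sub>R v)) (at t)" for t
    proof -
      have "((\<lambda>t. F (z + t *\<^sub>R v)) has_derivative (\<lambda>s. ddl [s *\<^sub>R v] F (z + t *\<^sub>R v))) (at t)"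
        by (rule has_derivative_compose[of "\<lambda>t. z + t *\<^sub>R v" "\<lambda>t. t *\<^sub>R v"])
          (auto intro!: derivative_eq_intros dF[simplified])
      moreover have "ddl [s *\<^sub>R v] F (z + t *\<^sub>R v) = ddl [v] F (z + t *\<^sub>R v) * s" for s
        using linear_scale[OF has_derivative_linear[OF dF[of "z + t *\<^sub>R v"]], of s v] by (simp add: mult.commute)
      ultimately show ?thesis by (simp add: has_field_derivative_def)
    qed
    obtain t where t: "F (z + h *\<^sub>R v) - F z = h * ddl [v] F (z + t *\<^sub>R v)"
      using MVT2[of 0 h "\<lambda>t. F (z + t *\<^sub>R v)" "\<lambda>t. ddl [v] F (z + t *\<^sub>R v)"] der h by auto
    have Qh: "Q n z = (F (z + h *\<^sub>R v) - F z) / h"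
      unfolding Q_def hv by (simp add: h_def)
    show ?thesis
    proof (cases "z \<in> cball 0 (R + norm v)")
      case True
      then show ?thesis using t h(1) M'[of "z + t *\<^sub>R v"] by (simp add: Qh)
    next
      case False
      then have z: "norm z > R + norm v" by simp
      have "norm (h *\<^sub>R v) \<le> norm v" using h by (simp add: mult_left_le_one_le)
      then have "norm (z + h *\<^sub>R v) > R" using z norm_triangle_ineq4[of "z + h *\<^sub>R v" "h *\<^sub>R v"] by simp
      moreover have "norm z > R" using z norm_ge_zero[of v] by linarith
      ultimately have "F (z + h *\<^sub>R v) = 0" "F z = 0" using R K(2) by (meson not_le)+
      then show ?thesis using False by (simp add: Qh)
    qed
  qed
  have "(\<lambda>n. integral\<^sup>L lborel (Q n)) \<longlonglongrightarrow> integral\<^sup>L lborel (ddl [v] F)"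
  proof (rule integral_dominated_convergence[where w = "\<lambda>z. M * indicator (cball 0 (R + norm v)) z"])
    show "integrable lborel (\<lambda>z. M * indicator (cball 0 (R + norm v)) z)"
      using emeasure_lborel_cball_finite by (intro integrable_mult_right integrable_real_indicator) auto
    show "ddl [v] F \<in> borel_measurable lborel" using cD by (simp add: borel_measurable_continuous_onI)
    show "Q n \<in> borel_measurable lborel" for n
      unfolding Q_def using cF
      by (auto intro!: borel_measurable_continuous_onI continuous_intros continuous_on_compose2[OF cF])
  qed (use lim bound in auto)
  then have "(\<lambda>n. 0) \<longlonglongrightarrow> integral\<^sup>L lborel (ddl [v] F)"
    by (simp only: Q0)
  then show ?thesis by (simp only: LIMSEQ_const_iff)
qed

text \<open>\<open>f\<close> may be singular at the boundary of \<open>G\<close>, but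
  \<open>f * \<phi>\<close> extended by zero is continuous on the whole space: it is so on
  \<open>G\<close> and off the support of \<open>\<phi>\<close>, two open sets that cover
  everything. This allows the passage from \<open>lebesgue_on G\<close> to
  \<open>lborel\<close>.\<close>

lemma
  assumes "open G" "continuous_on G f" "test_fn G \<phi>"
  shows integrable_test_fn: "integrable (lebesgue_on G) (\<lambda>z. f z * \<phi> z)" (is ?A)
    and integral_test_fn: "integral\<^sup>L (lebesgue_on G) (\<lambda>z. f z * \<phi> z)
      = integral\<^sup>L lborel (\<lambda>z. if z \<in> G then f z * \<phi> z else 0)" (is ?B)
    and integrable_test_fn_lborel: "integrable lborel (\<lambda>z. if z \<in> G then f z * \<phi> z else 0)" (is ?C)
proof -
  let ?K = "closure {z. \<phi> z \<noteq> 0}" and ?F = "\<lambda>z. if z \<in> G then f z * \<phi> z else 0"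
  have K: "compact ?K" "?K \<subseteq> G" and \<phi>: "Cinf_on UNIV \<phi>" using assms(3) by (auto simp: test_fn_def)
  have F0: "?F z = 0" if "z \<notin> ?K" for z
    using that closure_subset[of "{z. \<phi> z \<noteq> 0}"] by auto
  have "continuous_on G (\<lambda>z. f z * \<phi> z)"
    using Cinf_on_continuous[OF \<phi>, of "[]"] assms(2)
    by (auto intro!: continuous_intros intro: continuous_on_subset)
  then have "continuous_on G ?F" by (rule continuous_on_cong[THEN iffD1, rotated 2]) auto
  moreover have "continuous_on (- ?K) ?F"
    using F0 by (intro continuous_on_cong[THEN iffD1, OF refl _ continuous_on_const[of _ 0]]) auto
  ultimately have "continuous_on (G \<union> - ?K) ?F"
    using assms(1) by (intro continuous_on_open_Un) auto
  also have "G \<union> - ?K = UNIV" using K by auto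
  finally have cF: "continuous_on UNIV ?F" .
  show C: ?C using integrable_compact_support[OF cF K(1) F0] by blast
  have G: "G \<inter> space lebesgue \<in> sets lebesgue" using assms(1) by simp
  have eq: "?F = (\<lambda>z. indicator G z *\<^sub>R (f z * \<phi> z))" by auto
  show ?A
    using C unfolding integrable_restrict_space[OF G] eq[symmetric]
    by (simp add: integrable_completion borel_measurable_integrable)
  show ?B
    using C unfolding integral_restrict_space[OF G] eq[symmetric]
    by (simp add: integral_completion borel_measurable_integrable)
qed

text \<open>The extension of \<open>f * \<phi>\<close> by zero is smooth with compact support, so
  its directional derivative has integral zero; the Leibniz rule splits this into the two
  sides.\<close>

lemma Cinf_imp_weak_deriv:
  assumes G: "open G" and f: "Cinf_on G f"
  shows "weak_deriv G v f (ddl [v] f)"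
  unfolding weak_deriv_def
proof (intro allI impI)
  fix \<phi> assume t: "test_fn G \<phi>"
  let ?K = "closure {z. \<phi> z \<noteq> 0}" and ?F = "\<lambda>z. if z \<in> G then f z * \<phi> z else 0"
  have K: "compact ?K" "?K \<subseteq> G" and \<phi>: "Cinf_on UNIV \<phi>" using t by (auto simp: test_fn_def)
  have F0: "?F z = 0" if "z \<notin> ?K" for z
    using that closure_subset[of "{z. \<phi> z \<noteq> 0}"] by auto
  have "Cinf_on G (\<lambda>z. f z * \<phi> z)"
    using f \<phi> by (intro Cinf_on_mult G) (auto intro: Cinf_on_subset)
  then have "Cinf_on G ?F" by (rule Cinf_on_cong[OF G, rotated]) auto
  moreover have "Cinf_on (- ?K) ?F"
    by (rule Cinf_on_cong[OF _ _ Cinf_on_const[of _ 0]]) (use F0 in auto)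
  ultimately have "Cinf_on (G \<union> - ?K) ?F" using G by (intro Cinf_on_Un) auto
  also have "G \<union> - ?K = UNIV" using K by auto
  finally have F: "Cinf_on UNIV ?F" .
  have "ddl [v] ?F z = (if z \<in> G then f z * ddl [v] \<phi> z else 0) + (if z \<in> G then ddl [v] f z * \<phi> z else 0)" for z
  proof (cases "z \<in> G")
    case True
    have "ddl [v] ?F z = ddl [v] (\<lambda>z. f z * \<phi> z) z" by (rule ddl_cong[OF G _ True]) auto
    also have "\<dots> = f z * ddl [v] \<phi> z + ddl [v] f z * \<phi> z"
      using Cinf_on_differentiable_at[OF G f True, of "[]"] Cinf_on_differentiable_at[OF open_UNIV \<phi>, of z "[]"]
      by (intro ddl1 has_derivative_mult has_derivative_ddl1) auto
    finally show ?thesis using True by simp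
  next
    case False
    then have "ddl [v] ?F z = ddl [v] (\<lambda>_. 0) z"
      by (intro ddl_cong[of "- ?K"]) (use F0 K in auto)
    then show ?thesis using False by (simp add: ddl_zero)
  qed
  then have "0 = integral\<^sup>L lborel (\<lambda>z. (if z \<in> G then f z * ddl [v] \<phi> z else 0) + (if z \<in> G then ddl [v] f z * \<phi> z else 0))"
    using integral_ddl_compact_support[OF F K(1) F0, of v] by simp
  also have "\<dots> = integral\<^sup>L lborel (\<lambda>z. if z \<in> G then f z * ddl [v] \<phi> z else 0)
      + integral\<^sup>L lborel (\<lambda>z. if z \<in> G then ddl [v] f z * \<phi> z else 0)"
    using Cinf_on_continuous[OF f, of "[]"] Cinf_on_continuous[OF f, of "[v]"]
    by (intro Bochner_Integration.integral_add integrable_test_fn_lborel G test_fn_ddl t) auto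
  finally show "integral\<^sup>L (lebesgue_on G) (\<lambda>z. f z * ddl [v] \<phi> z)
        = - integral\<^sup>L (lebesgue_on G) (\<lambda>z. ddl [v] f z * \<phi> z)"
    using Cinf_on_continuous[OF f, of "[]"] Cinf_on_continuous[OF f, of "[v]"]
    by (subst (1 2) integral_test_fn[OF G]) (auto intro: test_fn_ddl t simp del: ddl.simps(2))
qed

text \<open>Dyadic annuli around \<open>p\<close> reduce the integral to a geometric series.\<close>

lemma integrable_norm_powr_ball:
  fixes p :: complex
  assumes b: "-2 < b" "b \<le> 0"
  shows "integrable lborel (\<lambda>z. indicator (ball p 1) z * norm (z - p) powr b)"
proof (rule integrableI_bounded)
  \<comment> \<open>The value at the inner radius of the annulus between
    \<open>1 / 2 ^ Suc k\<close> and \<open>1 / 2 ^ k\<close>; it bounds the integrand there because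
    \<open>b \<le> 0\<close>.\<close>
  define c where "c k = (1 / 2 ^ Suc k) powr b" for k :: nat
  have c: "c k \<ge> 0" for k by (simp add: c_def)
  have re_powr: "(\<Sum>k. ennreal (c k) * indicator (ball p (1 / 2 ^ k)) z) \<ge> ennreal (norm (indicator (ball p 1) z * norm (z - p) powr b))" for z
  proof (cases "z \<in> ball p 1 \<and> z \<noteq> p")
    \<comment> \<open>The integrand is 0 here: either \<open>z\<close> is outside the disc, or
      \<open>z = p\<close>, where \<open>0 powr b = 0\<close>.\<close>
    case False
    then show ?thesis by (auto simp: indicator_def)
  next
    case True
    then have z: "0 < norm (z - p)" "norm (z - p) < 1" by (auto simp: dist_norm norm_minus_commute)
    define k where "k = (LEAST k. 1 / 2 ^ Suc k \<le> norm (z - p))"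
    obtain m where "(1/2) ^ m < norm (z - p)" using real_arch_pow_inv[of "norm (z - p)" "1/2"] z by auto
    then have "1 / 2 ^ Suc m \<le> norm (z - p)" 
      by (simp add: power_one_over field_simps)
    then have k: "1 / 2 ^ Suc k \<le> norm (z - p)" unfolding k_def by (rule LeastI)
    have k': "norm (z - p) < 1 / 2 ^ k"
    proof (cases k)
      case (Suc j)
      then have "\<not> 1 / 2 ^ Suc j \<le> norm (z - p)" unfolding k_def by (intro not_less_Least) simp
      then show ?thesis using Suc by simp
    qed (use z in simp)
    have "norm (z - p) powr b \<le> c k"
      unfolding c_def by (rule powr_mono2') (use k b in auto)
    then have "ennreal (norm (indicator (ball p 1) z * norm (z - p) powr b)) \<le> ennreal (c k) * indicator (ball p (1 / 2 ^ k)) z"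
      using True k' by (simp add: dist_norm norm_minus_commute ennreal_leI)
    also have "\<dots> \<le> (\<Sum>k. ennreal (c k) * indicator (ball p (1 / 2 ^ k)) z)"
      using sum_le_suminf[OF summableI, of "{k}"] by simp
    finally show ?thesis .
  qed
  have "(\<integral>\<^sup>+ z. ennreal (norm (indicator (ball p 1) z * norm (z - p) powr b)) \<partial>lborel)
     \<le> (\<integral>\<^sup>+ z. (\<Sum>k. ennreal (c k) * indicator (ball p (1 / 2 ^ k)) z) \<partial>lborel)"
    by (intro nn_integral_mono re_powr)
  also have "\<dots> = (\<Sum>k. \<integral>\<^sup>+ z. ennreal (c k) * indicator (ball p (1 / 2 ^ k)) z \<partial>lborel)"
    by (intro nn_integral_suminf borel_measurable_times_ennreal borel_measurable_const borel_measurable_indicator) auto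
  \<comment> \<open>The area of the disc contributes \<open>4 powr (- k)\<close> and
    \<open>c k\<close> contributes \<open>2 powr (- b * k)\<close>. The resulting ratio
    \<open>1 / 2 powr (b + 2)\<close> is below 1 because \<open>b > -2\<close>.\<close>
  also have "\<dots> = (\<Sum>k. ennreal (2 powr (- b) * unit_ball_vol 2 * (1 / 2 powr (b + 2)) ^ k))"
  proof (rule suminf_cong)
    fix k
    have "(\<integral>\<^sup>+ z. ennreal (c k) * indicator (ball p (1 / 2 ^ k)) z \<partial>lborel)
      = ennreal (c k) * ennreal (unit_ball_vol 2 * (1 / 2 ^ k) ^ 2)"
      by (subst nn_integral_cmult_indicator) (auto simp: emeasure_ball)
    also have "\<dots> = ennreal (2 powr (- b) * unit_ball_vol 2 * (1 / 2 powr (b + 2)) ^ k)"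
    proof -
      have "c k = 2 powr (- b) * 2 powr (- b * k)"
      proof -
        have "1 / 2 ^ Suc k = (2::real) powr (- (real k + 1))"
          by (simp only: powr_minus_divide) (simp add: powr_add powr_realpow)
        then show ?thesis
          unfolding c_def by (simp add: powr_powr algebra_simps flip: powr_add)
      qed
      moreover have "(1 / 2 ^ k) ^ 2 = (2::real) powr (- 2 * k)"
        by (simp add: powr_minus_divide powr_realpow[symmetric] power2_eq_square flip: powr_add)
      moreover have "(1 / 2 powr (b + 2)) ^ k = 2 powr (- (b + 2) * k)"
        by (simp add: powr_power algebra_simps flip: powr_minus_divide)
      ultimately have "c k * (unit_ball_vol 2 * (1 / 2 ^ k) ^ 2) = 2 powr (- b) * unit_ball_vol 2 * (1 / 2 powr (b + 2)) ^ k"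
        by (simp add: algebra_simps flip: powr_add)
      then show ?thesis by (metis c ennreal_mult' )
    qed
    finally show "(\<integral>\<^sup>+ z. ennreal (c k) * indicator (ball p (1 / 2 ^ k)) z \<partial>lborel)
      = ennreal (2 powr (- b) * unit_ball_vol 2 * (1 / 2 powr (b + 2)) ^ k)" .
  qed
  also have "\<dots> < \<infinity>"
  proof -
    have "(2::real) powr 0 < 2 powr (b + 2)" using b by (intro powr_less_mono) auto
    then have "1 / 2 powr (b + 2) < (1::real)" by simp
    then have "summable (\<lambda>k. 2 powr (- b) * unit_ball_vol 2 * (1 / 2 powr (b + 2)) ^ k)"
      by (intro summable_mult summable_geometric) auto
    then show ?thesis by (subst suminf_ennreal2) auto
  qed
  finally show "(\<integral>\<^sup>+ z. ennreal (norm (indicator (ball p 1) z * norm (z - p) powr b)) \<partial>lborel) < \<infinity>" .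
  have "(\<lambda>z. norm (z - p) powr b) \<in> borel_measurable lborel" by measurable
  then show "(\<lambda>z. indicator (ball p 1) z * norm (z - p) powr b) \<in> borel_measurable lborel"
    by (intro borel_measurable_times borel_measurable_indicator) auto
qed

section \<open>Square integrability\<close>

lemma L2_bound:
  fixes f :: "'a::euclidean_space \<Rightarrow> real"
  assumes V: "open V" and f: "continuous_on V f" and w: "integrable lborel w"
    and bd: "\<And>z. z \<in> V \<Longrightarrow> (f z)\<^sup>2 \<le> w z"
  shows "L2 V f"
proof -
  have V': "V \<inter> space lebesgue \<in> sets lebesgue" using V by simp
  have m: "f \<in> borel_measurable (lebesgue_on V)"
    using f V by (intro continuous_imp_measurable_on_sets_lebesgue) auto
  have "integrable lborel (\<lambda>z. indicator V z *\<^sub>R w z)"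
    using w V by (intro integrable_mult_indicator) auto
  then have "integrable (lebesgue_on V) w"
    unfolding integrable_restrict_space[OF V']
    by (simp add: integrable_completion borel_measurable_integrable)
  then have "integrable (lebesgue_on V) (\<lambda>z. (f z)\<^sup>2)"
    by (rule Bochner_Integration.integrable_bound) (use m bd in \<open>force simp: space_restrict_space intro: order_trans[OF _ abs_ge_self]\<close>)+
  then show ?thesis using m by (simp add: L2_def)
qed

text \<open>Squaring doubles the exponent, and \<open>2 * a > -2\<close> is the integrability
  threshold at a point of the plane. Applied with \<open>a = \<mu> - 1\<close> to the first
  derivatives of \<open>u\<close> and to its Laplacian.\<close>

lemma L2_powr_bound:
  fixes p :: complex
  assumes V: "open V" and f: "continuous_on V f" and a: "-1 < a" "a \<le> 0"
    and bd: "\<And>z. z \<in> V \<Longrightarrow> norm (z - p) < 1 \<Longrightarrow> \<bar>f z\<bar> \<le> C * norm (z - p) powr a"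
    and out: "\<And>z. z \<in> V \<Longrightarrow> norm (z - p) \<ge> 1 \<Longrightarrow> f z = 0"
  shows "L2 V f"
proof (rule L2_bound[OF V f])
  show "integrable lborel (\<lambda>z. C\<^sup>2 * (indicator (ball p 1) z * norm (z - p) powr (2 * a)))"
    using a by (intro integrable_mult_right integrable_norm_powr_ball) auto
  show "(f z)\<^sup>2 \<le> C\<^sup>2 * (indicator (ball p 1) z * norm (z - p) powr (2 * a))" if "z \<in> V" for z
  proof (cases "norm (z - p) < 1")
    case True
    have "\<bar>f z\<bar>\<^sup>2 \<le> (C * norm (z - p) powr a)\<^sup>2"
      using bd[OF that True] by (intro power_mono) auto
    moreover have "(C * norm (z - p) powr a)\<^sup>2 = C\<^sup>2 * norm (z - p) powr (2 * a)"
      by (simp add: power_mult_distrib power2_eq_square flip: powr_add)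
    ultimately show ?thesis using True
      by (simp add: dist_norm norm_minus_commute)
  next
    case False
    then show ?thesis using out[OF that] by simp
  qed
qed

section \<open>Homogeneous functions at the corner\<close>

definition growth :: "complex \<Rightarrow> complex set \<Rightarrow> real \<Rightarrow> (complex \<Rightarrow> real) \<Rightarrow> bool" where
  "growth p S a f \<longleftrightarrow> (\<exists>C. \<forall>z\<in>S. \<bar>f z\<bar> \<le> C * norm (z - p) powr a)"

lemma graded_growth: "open S \<Longrightarrow> graded S (growth p S)"
proof unfold_locales
  fix a f g assume "growth p S a f" "growth p S a g"
  then obtain C D where "\<forall>z\<in>S. \<bar>f z\<bar> \<le> C * norm (z - p) powr a" "\<forall>z\<in>S. \<bar>g z\<bar> \<le> D * norm (z - p) powr a"
    unfolding growth_def by blast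
  then have "\<forall>z\<in>S. \<bar>f z + g z\<bar> \<le> (C + D) * norm (z - p) powr a"
    by (auto simp: distrib_right intro!: order_trans[OF abs_triangle_ineq] add_mono)
  then show "growth p S a (\<lambda>z. f z + g z)" unfolding growth_def by blast
next
  fix a b f g assume "growth p S a f" "growth p S b g"
  then obtain C D where C: "\<forall>z\<in>S. \<bar>f z\<bar> \<le> C * norm (z - p) powr a" and D: "\<forall>z\<in>S. \<bar>g z\<bar> \<le> D * norm (z - p) powr b"
    unfolding growth_def by blast
  have "\<bar>f z * g z\<bar> \<le> (C * D) * norm (z - p) powr (a + b)" if "z \<in> S" for z
  proof -
    have "\<bar>f z\<bar> * \<bar>g z\<bar> \<le> (C * norm (z - p) powr a) * (D * norm (z - p) powr b)"
      using C[rule_format, OF that] D[rule_format, OF that] by (intro mult_mono) auto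
    then show ?thesis by (simp add: abs_mult powr_add mult_ac)
  qed
  then show "growth p S (a + b) (\<lambda>z. f z * g z)" unfolding growth_def by blast
qed (auto simp: growth_def)

lemma growth_mono:
  assumes "S \<subseteq> ball p 1" "b \<le> a" "growth p S a f"
  shows "growth p S b f"
proof -
  obtain C where C: "\<forall>z\<in>S. \<bar>f z\<bar> \<le> C * norm (z - p) powr a" using assms unfolding growth_def by blast
  have "\<bar>f z\<bar> \<le> \<bar>C\<bar> * norm (z - p) powr b" if "z \<in> S" for z
  proof -
    have "norm (z - p) \<le> 1" using assms(1) that by (auto simp: dist_norm norm_minus_commute)
    then have "norm (z - p) powr a \<le> norm (z - p) powr b"
      using assms(2) by (intro powr_mono') auto
    then have "C * norm (z - p) powr a \<le> \<bar>C\<bar> * norm (z - p) powr b"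
      by (intro mult_mono) auto
    then show ?thesis using C[rule_format, OF that] by linarith
  qed
  then show ?thesis unfolding growth_def by blast
qed

lemma Ck_growth_mono:
  "S \<subseteq> ball p 1 \<Longrightarrow> b \<le> a \<Longrightarrow> Ck (growth p S) S k a f \<Longrightarrow> Ck (growth p S) S k b f"
  unfolding Ck_def by (meson growth_mono diff_right_mono)

lemma Cinf_bounded:
  fixes f :: "complex \<Rightarrow> real"
  assumes "Cinf_on UNIV f"
  obtains M where "M > 0" "\<And>z. z \<in> cball p 1 \<Longrightarrow> \<bar>ddl vs f z\<bar> \<le> M"
proof -
  have "continuous_on (cball p 1) (ddl vs f)"
    using Cinf_on_continuous[OF assms] continuous_on_subset by blast
  then have "bounded (ddl vs f ` cball p 1)"
    by (meson compact_continuous_image compact_imp_bounded compact_cball)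
  then show ?thesis using that unfolding bounded_pos by auto
qed

text \<open>All derivatives are bounded near \<open>p\<close>, which satisfies every requirement
  \<open>O(r^b)\<close> with \<open>b \<le> 0\<close>. For weight one only the function itself must
  do better, and \<open>f p = 0\<close> with the mean value inequality gives
  \<open>O(r)\<close>.\<close>

lemma Ck_growth_Cinf:
  assumes f: "Cinf_on UNIV f" and S: "S \<subseteq> ball p 1" "p \<notin> S"
  shows "Ck (growth p S) S k 0 f" and "f p = 0 \<Longrightarrow> Ck (growth p S) S k 1 f"
proof -
  have d: "ddl vs f differentiable_on S" for vs
    using Cinf_on_subset[OF f] by (simp add: Cinf_on_def)
  have g: "growth p S a (ddl vs f)" if "a \<le> 0" for vs a
  proof -
    obtain M where "\<And>z. z \<in> cball p 1 \<Longrightarrow> \<bar>ddl vs f z\<bar> \<le> M" using Cinf_bounded[OF f] by blast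
    then have "growth p S 0 (ddl vs f)"
      using S unfolding growth_def by (intro exI[of _ M]) (force simp: powr_def dist_norm)
    then show ?thesis by (rule growth_mono[OF S(1) that])
  qed
  show "Ck (growth p S) S k 0 f" unfolding Ck_def using d g by auto
  assume f0: "f p = 0"
  have "growth p S 1 f"
  proof -
    obtain M where M: "M > 0" "\<And>z. z \<in> cball p 1 \<Longrightarrow> \<bar>ddl [1] f z\<bar> \<le> M" using Cinf_bounded[OF f] by blast
    obtain N where N: "N > 0" "\<And>z. z \<in> cball p 1 \<Longrightarrow> \<bar>ddl [\<i>] f z\<bar> \<le> N" using Cinf_bounded[OF f] by blast
    have D: "(f has_derivative (\<lambda>v. ddl [v] f z)) (at z)" for z
      using Cinf_on_differentiable_at[OF open_UNIV f, of z "[]"] by (intro has_derivative_ddl1) simp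
    have "norm (f z - f p) \<le> (M + N) * norm (z - p)" if "z \<in> S" for z
    proof (rule differentiable_bound[OF convex_cball])
      fix x assume x: "x \<in> cball p 1"
      show "(f has_derivative (\<lambda>v. ddl [v] f x)) (at x within cball p 1)"
        using D by (rule has_derivative_at_withinI)
      show "onorm (\<lambda>v. ddl [v] f x) \<le> M + N"
      proof (rule onorm_le)
        fix v
        have l: "linear (\<lambda>v. ddl [v] f x)" using D has_derivative_linear by blast
        have "ddl [v] f x = ddl [Re v *\<^sub>R 1 + Im v *\<^sub>R \<i>] f x"
          by (metis complex_eq mult.commute scaleR_conv_of_real mult.right_neutral)
        also have "\<dots> = Re v * ddl [1] f x + Im v * ddl [\<i>] f x"
          using linear_add[OF l] linear_scale[OF l] by (metis real_scaleR_def)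
        finally have "\<bar>ddl [v] f x\<bar> \<le> \<bar>Re v\<bar> * \<bar>ddl [1] f x\<bar> + \<bar>Im v\<bar> * \<bar>ddl [\<i>] f x\<bar>"
          by (metis abs_triangle_ineq abs_mult)
        also have "\<dots> \<le> norm v * M + norm v * N"
          using M N x abs_Re_le_cmod abs_Im_le_cmod by (intro add_mono mult_mono) auto
        finally show "norm (ddl [v] f x) \<le> (M + N) * norm v" by (simp only: real_norm_def) (simp add: algebra_simps)
      qed
    qed (use S that in auto)
    then show ?thesis using f0 unfolding growth_def by (auto simp: powr_def)
  qed
  then show "Ck (growth p S) S k 1 f"
    unfolding Ck_def
  proof (intro allI impI conjI d)
    show "growth p S (1 - real (length vs)) (ddl vs f)" for vs
      using g[of "1 - real (length vs)" vs] \<open>growth p S 1 f\<close> by (cases vs) (auto simp del: ddl.simps(2))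
  qed
qed

text \<open>For a unit vector \<open>n\<close>, the plane cut along the ray opposite to
  \<open>n\<close>, where the principal power of \<open>(z - p) / n\<close> is holomorphic. Apart
  from \<open>p\<close> it contains the closed half-plane, so functions smooth here are smooth
  across the boundary near \<open>p\<close>.\<close>

definition slit :: "complex \<Rightarrow> complex \<Rightarrow> complex set" where
  "slit p n = {z. (z - p) / n \<notin> \<real>\<^sub>\<le>\<^sub>0}"

lemma open_slit: "open (slit p n)"
proof -
  have "slit p n = (\<lambda>z. (z - p) * inverse n) -` (- \<real>\<^sub>\<le>\<^sub>0)" by (auto simp: slit_def divide_inverse)
  then show ?thesis by (simp only:) (intro open_vimage continuous_intros; simp add: open_Compl)
qed

lemma not_in_slit: "p \<notin> slit p n"
  by (simp add: slit_def)

text \<open>The complex coefficient keeps the family closed under directional derivatives, absorbing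
  the exponent and the direction. \<open>c = 1\<close> and \<open>c = - \<i>\<close> give the real
  and the imaginary part of the power.\<close>

definition re_powr :: "complex \<Rightarrow> complex \<Rightarrow> complex \<Rightarrow> real \<Rightarrow> complex \<Rightarrow> real" where
  "re_powr p n c a z = Re (c * ((z - p) / n) powr of_real a)"

lemma has_derivative_re_powr:
  assumes "z \<in> slit p n"
  shows "(re_powr p n c a has_derivative (\<lambda>v. re_powr p n (c * of_real a / n * v) (a - 1) z)) (at z)"
proof -
  have n: "n \<noteq> 0" using assms by (auto simp: slit_def)
  have "((\<lambda>z. c * ((z - p) / n) powr of_real a) has_field_derivative
      c * (of_real a * ((z - p) / n) powr (of_real a - 1) * (1 / n))) (at z)"
    by (rule DERIV_cmult, rule DERIV_chain2[OF has_field_derivative_powr])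
      (use assms n in \<open>auto intro!: derivative_eq_intros simp: slit_def\<close>)
  then have "((\<lambda>z. Re (c * ((z - p) / n) powr of_real a)) has_derivative
      (\<lambda>v. Re (c * (of_real a * ((z - p) / n) powr (of_real a - 1) * (1 / n)) * v))) (at z)"
    by (intro has_derivative_Re has_field_derivative_imp_has_derivative)
  then show ?thesis unfolding re_powr_def[abs_def] by (simp add: mult_ac divide_inverse)
qed

lemma ddl_re_powr: "z \<in> slit p n \<Longrightarrow> ddl [v] (re_powr p n c a) z = re_powr p n (c * of_real a / n * v) (a - 1) z"
  by (rule ddl1) (rule has_derivative_re_powr)

lemma re_powr_differentiable_on: "S \<subseteq> slit p n \<Longrightarrow> re_powr p n c a differentiable_on S"
  using has_derivative_re_powr
  by (metis differentiable_at_imp_differentiable_on differentiable_def subset_iff)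

text \<open>Each derivative is again a member of the family with the exponent lowered by one, so a
  bound for the family settles all orders.\<close>

lemma Ck_re_powr:
  assumes "open S" "S \<subseteq> slit p n" "graded S B" "\<And>c a. B a (re_powr p n c a)"
  shows "Ck B S k a (re_powr p n c a)"
proof (induction k arbitrary: c a)
  case 0
  then show ?case using re_powr_differentiable_on[OF assms(2)] assms(4) by (simp add: Ck_0)
next
  case (Suc k)
  have "Ck B S k (a - 1) (ddl [v] (re_powr p n c a))" for v
  proof (rule graded.Ck_cong[OF assms(3) _ Suc])
    fix z assume "z \<in> S"
    then have "z \<in> slit p n" using assms(2) by blast
    then show "re_powr p n (c * of_real a / n * v) (a - 1) z = ddl [v] (re_powr p n c a) z"
      by (rule ddl_re_powr[symmetric])
  qed
  then show ?case using re_powr_differentiable_on[OF assms(2)] assms(4) by (simp add: Ck_Suc)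
qed

lemma Cinf_on_re_powr: "Cinf_on (slit p n) (re_powr p n c a)"
  unfolding Cinf_on_iff_Ck[where a=a] using Ck_re_powr[OF open_slit order_refl graded_True[OF open_slit]] by blast

lemma norm_powr_of_real: "w \<noteq> 0 \<Longrightarrow> norm (w powr of_real a) = norm w powr a" for w :: complex
  by (simp add: powr_def)

lemma growth_re_powr:
  assumes "norm n = 1" "p \<notin> S" shows "growth p S a (re_powr p n c a)"
  unfolding growth_def
proof (intro exI ballI)
  fix z assume "z \<in> S"
  then have "(z - p) / n \<noteq> 0" using assms by auto
  then have "norm (c * ((z - p) / n) powr of_real a) = norm c * norm (z - p) powr a"
    using assms by (simp add: norm_mult norm_powr_of_real norm_divide)
  then show "\<bar>re_powr p n c a z\<bar> \<le> norm c * norm (z - p) powr a"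
    unfolding re_powr_def by (metis abs_Re_le_cmod)
qed

lemma halfplane_unit:
  assumes "norm n = 1" shows "halfplane p n = {z. Re ((z - p) / n) > 0}"
proof -
  have "n * cnj n = 1" using assms complex_norm_square[of n] by simp
  then have "cnj n = inverse n" by (metis inverse_unique)
  then show ?thesis by (simp add: halfplane_def divide_inverse)
qed

lemma halfplane_subset_slit:
  assumes "norm n = 1" shows "halfplane p n \<subseteq> slit p n"
  unfolding halfplane_unit[OF assms] slit_def by (auto elim!: nonpos_Reals_cases)

section \<open>The singular solution\<close>

text \<open>Intended: \<open>p\<close> a corner, \<open>n\<close> the inner unit normal,
  \<open>\<mu>\<close> the singular exponent. As \<open>d < e\<close>, \<open>u\<close> vanishes on
  an annulus within the disc of radius \<open>e\<close>, so what is known in that disc glues with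
  zero outside; \<open>e \<le> 1\<close> makes \<open>growth_mono\<close> applicable.
  \<open>E2 p = 0\<close> keeps the third term of \<open>u\<close> out of the leading part.\<close>

locale corner_function =
  fixes p n :: complex and \<mu> d e :: real and E1 E2 :: "complex \<Rightarrow> real"
  assumes n: "norm n = 1" and \<mu>: "0 < \<mu>" "\<mu> < 1" and de: "0 < d" "d < e" "e \<le> 1"
    and E1: "Cinf_on UNIV E1" and E2: "Cinf_on UNIV E2" "E2 p = 0"
begin

definition u :: "complex \<Rightarrow> real" where
  "u z = bump p d z * (re_powr p n 1 \<mu> z + E1 z * re_powr p n (- \<i>) \<mu> z
     + E2 z * Im ((z - p) / n) * re_powr p n (- \<i>) (\<mu> - 1) z)"

definition S :: "complex set" where "S = slit p n \<inter> ball p e"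

text \<open>Leading coefficient with the smooth factors frozen at \<open>p\<close>:
  \<open>Re (c0 * w)\<close> is \<open>bump p d p * (Re w + E1 p * Im w)\<close>.\<close>

definition c0 :: complex where "c0 = of_real (bump p d p) * (1 - \<i> * of_real (E1 p))"

definition v :: "complex \<Rightarrow> real" where "v z = u z - re_powr p n c0 \<mu> z"

lemma S_facts: "open S" "S \<subseteq> slit p n" "S \<subseteq> ball p 1" "p \<notin> S"
  using open_slit not_in_slit de by (auto simp: S_def)

lemma u_zero: "d \<le> norm (z - p) \<Longrightarrow> u z = 0"
  using de bump_eq_0_iff[of d p z] by (simp add: u_def)

lemma Cinf_Im: "Cinf_on T (\<lambda>z. Im ((z - p) / n))"
proof -
  have "bounded_linear (\<lambda>z. Im (z * (1 / n)))"
    by (intro bounded_linear_intros bounded_linear_compose[OF bounded_linear_Im])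
  then have "Cinf_on UNIV (\<lambda>z. - Im (p / n) + Im (z * (1 / n)))"
    by (intro Cinf_on_add Cinf_on_const Cinf_on_linear open_UNIV)
  then have "Cinf_on UNIV (\<lambda>z. Im ((z - p) / n))"
    by (rule Cinf_on_cong[OF open_UNIV, rotated]) (simp add: diff_divide_distrib)
  then show ?thesis by (rule Cinf_on_subset) simp
qed

lemma Cinf_u_slit: "Cinf_on (slit p n) u"
  unfolding u_def[abs_def]
  by (intro Cinf_on_add Cinf_on_mult open_slit Cinf_on_bump Cinf_Im Cinf_on_re_powr
      Cinf_on_subset[OF E1] Cinf_on_subset[OF E2(1)]) auto

lemma Cinf_u: "Cinf_on (slit p n \<union> {z. d < norm (z - p)}) u"
proof (rule Cinf_on_Un[OF open_slit _ Cinf_u_slit])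
  show "open {z. d < norm (z - p)}" by (intro open_Collect_less continuous_intros)
  then show "Cinf_on {z. d < norm (z - p)} u"
    by (rule Cinf_on_cong[OF _ _ Cinf_on_const[of _ 0]]) (use u_zero in auto)
qed

lemma open_dom: "open (slit p n \<union> {z. d < norm (z - p)})"
  by (intro open_Un open_slit open_Collect_less continuous_intros)

lemma Ck_growth_re_powr: "Ck (growth p S) S k a (re_powr p n c a)"
  by (rule Ck_re_powr[OF S_facts(1,2) graded_growth[OF S_facts(1)] growth_re_powr[OF n S_facts(4)]])

text \<open>\<open>v\<close> is a sum of four products, each with a smooth factor vanishing at
  \<open>p\<close>: the freezing errors of the cutoff and of \<open>E1\<close>, and
  \<open>E2\<close> itself. Such a factor has weight one and lifts \<open>\<mu>\<close> to
  \<open>\<mu> + 1\<close>; in the \<open>E2\<close> term the weight one of \<open>Im\<close> makes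
  up for the power \<open>\<mu> - 1\<close>.\<close>

lemma Ck_growth_v: "Ck (growth p S) S k (\<mu> + 1) v"
proof -
  interpret graded S "growth p S" by (rule graded_growth[OF S_facts(1)])
  note C0 = Ck_growth_Cinf(1)[OF _ S_facts(3,4), of _ k]
  note C1 = Ck_growth_Cinf(2)[OF _ S_facts(3,4), of _ k]
  have minus: "Cinf_on UNIV (\<lambda>z. f z - f p)" if "Cinf_on UNIV f" for f :: "complex \<Rightarrow> real"
    using Cinf_on_add[OF open_UNIV that Cinf_on_const[of _ "- f p"]] by simp
  have A: "Ck (growth p S) S k (1 + (\<mu> + 0)) (\<lambda>z. (bump p d z - bump p d p) * (re_powr p n 1 \<mu> z * 1))"
    by (intro Ck_mult C1 C0 Ck_growth_re_powr minus Cinf_on_bump Cinf_on_const) auto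
  have B: "Ck (growth p S) S k (1 + (\<mu> + 0)) (\<lambda>z. (bump p d z - bump p d p) * (re_powr p n (- \<i>) \<mu> z * E1 z))"
    by (intro Ck_mult C1 C0 Ck_growth_re_powr minus Cinf_on_bump E1) auto
  have C: "Ck (growth p S) S k (1 + (\<mu> + 0)) (\<lambda>z. (E1 z - E1 p) * (re_powr p n (- \<i>) \<mu> z * bump p d p))"
    by (intro Ck_mult C1 C0 Ck_growth_re_powr minus Cinf_on_const E1) auto
  have D: "Ck (growth p S) S k (1 + (1 + ((\<mu> - 1) + 0))) (\<lambda>z. E2 z * (Im ((z - p) / n) * (re_powr p n (- \<i>) (\<mu> - 1) z * bump p d z)))"
    by (intro Ck_mult C1 C0 Ck_growth_re_powr Cinf_Im Cinf_on_bump E2) auto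
  have pwc: "re_powr p n c0 \<mu> z = bump p d p * (re_powr p n 1 \<mu> z + E1 p * re_powr p n (- \<i>) \<mu> z)" for z
    by (simp add: re_powr_def c0_def algebra_simps)
  have "Ck (growth p S) S k (\<mu> + 1) (\<lambda>z. (bump p d z - bump p d p) * (re_powr p n 1 \<mu> z * 1)
      + (bump p d z - bump p d p) * (re_powr p n (- \<i>) \<mu> z * E1 z)
      + (E1 z - E1 p) * (re_powr p n (- \<i>) \<mu> z * bump p d p)
      + E2 z * (Im ((z - p) / n) * (re_powr p n (- \<i>) (\<mu> - 1) z * bump p d z)))"
    by (intro Ck_add) (use A B C D in \<open>simp_all add: add.commute\<close>)
  then show ?thesis
    by (rule Ck_cong[rotated]) (simp add: v_def u_def pwc algebra_simps)
qed

lemma Ck_growth_u: "Ck (growth p S) S k \<mu> u"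
proof -
  interpret graded S "growth p S" by (rule graded_growth[OF S_facts(1)])
  have "Ck (growth p S) S k \<mu> (\<lambda>z. re_powr p n c0 \<mu> z + v z)"
    using Ck_growth_mono[OF S_facts(3) _ Ck_growth_v, of \<mu>] by (intro Ck_add Ck_growth_re_powr) auto
  then show ?thesis by (rule Ck_cong[rotated]) (simp add: v_def)
qed

lemma ddl_u_bound:
  obtains C where "\<And>z. z \<in> S \<Longrightarrow> \<bar>ddl vs u z\<bar> \<le> C * norm (z - p) powr (\<mu> - length vs)"
  using Ck_growth_u[of "length vs"] unfolding Ck_def growth_def by blast

lemma ddl_v_bound:
  obtains C where "\<And>z. z \<in> S \<Longrightarrow> \<bar>ddl vs v z\<bar> \<le> C * norm (z - p) powr (\<mu> + 1 - length vs)"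
  using Ck_growth_v[of "length vs"] unfolding Ck_def growth_def by blast

lemma ddl_u_eq:
  assumes z: "z \<in> S"
  shows "ddl [w, w] u z = re_powr p n (c0 * of_real \<mu> / n * w * of_real (\<mu> - 1) / n * w) (\<mu> - 2) z + ddl [w, w] v z"
proof -
  have v: "Cinf_on S v"
  proof -
    have "Cinf_on S (\<lambda>z. u z + (-1) * re_powr p n c0 \<mu> z)"
      using S_facts by (intro Cinf_on_add Cinf_on_mult Cinf_on_const Cinf_on_subset[OF Cinf_u_slit] Cinf_on_subset[OF Cinf_on_re_powr])
    then show ?thesis by (simp add: v_def[abs_def])
  qed
  have sl: "x \<in> slit p n" if "x \<in> S" for x using that S_facts by auto
  have 1: "ddl [w] u x = re_powr p n (c0 * of_real \<mu> / n * w) (\<mu> - 1) x + ddl [w] v x" if x: "x \<in> S" for x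
  proof -
    have "ddl [w] u x = ddl [w] (\<lambda>z. re_powr p n c0 \<mu> z + v z) x"
      by (rule ddl_cong[OF S_facts(1) _ x]) (simp add: v_def)
    also have "\<dots> = re_powr p n (c0 * of_real \<mu> / n * w) (\<mu> - 1) x + ddl [w] v x"
      using Cinf_on_differentiable_at[OF S_facts(1) v x, of "[]"]
      by (intro ddl1 has_derivative_add has_derivative_re_powr sl x has_derivative_ddl1) simp
    finally show ?thesis .
  qed
  have "ddl [w, w] u z = ddl [w] (ddl [w] u) z" by simp
  also have "\<dots> = ddl [w] (\<lambda>x. re_powr p n (c0 * of_real \<mu> / n * w) (\<mu> - 1) x + ddl [w] v x) z"
    by (rule ddl_cong[OF S_facts(1) 1 z])
  also have "\<dots> = re_powr p n (c0 * of_real \<mu> / n * w * of_real (\<mu> - 1) / n * w) (\<mu> - 1 - 1) z + ddl [w] (ddl [w] v) z"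
    using Cinf_on_differentiable_at[OF S_facts(1) v z, of "[w]"]
    by (intro ddl1 has_derivative_add has_derivative_re_powr sl z has_derivative_ddl1) simp
  finally show ?thesis by (simp add: diff_diff_eq)
qed

text \<open>The second derivatives of the leading power in the directions 1 and \<open>\<i>\<close>
  differ by the factor \<open>\<i> * \<i> = -1\<close> and cancel. What is left is
  \<open>O(r^(\<mu>-1))\<close>.\<close>

lemma lap_u_eq:
  assumes "z \<in> S" shows "lap u z = ddl [1, 1] v z + ddl [\<i>, \<i>] v z"
proof -
  have "re_powr p n (c0 * of_real \<mu> / n * \<i> * of_real (\<mu> - 1) / n * \<i>) (\<mu> - 2) z
      = - re_powr p n (c0 * of_real \<mu> / n * 1 * of_real (\<mu> - 1) / n * 1) (\<mu> - 2) z"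
  proof -
    have "c0 * of_real \<mu> / n * \<i> * of_real (\<mu> - 1) / n * \<i> = - (c0 * of_real \<mu> / n * 1 * of_real (\<mu> - 1) / n * 1)"
      by (simp add: divide_inverse mult_ac)
    then show ?thesis unfolding re_powr_def by (simp only: mult_minus_left uminus_complex.sel)
  qed
  then show ?thesis
    unfolding lap_def ddl_u_eq[OF assms] by linarith
qed

lemma ddl_u_zero:
  assumes "d < norm (z - p)" shows "ddl vs u z = 0"
proof -
  have "ddl vs u z = ddl vs (\<lambda>_. 0) z"
    by (rule ddl_cong[of "{z. d < norm (z - p)}"])
      (use assms u_zero in \<open>auto intro!: open_Collect_less continuous_intros\<close>)
  then show ?thesis by (simp add: ddl_zero)
qed

text \<open>The rotation \<open>p + \<sigma> * (z - p)\<close> is written as a constant plus a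
  linear map to fit \<open>ddl_affine\<close>. It preserves the distance to \<open>p\<close>, so the
  bounds for \<open>u\<close> carry over; first derivatives are \<open>O(r^(\<mu>-1))\<close>,
  square integrable because \<open>\<mu> > 0\<close>.\<close>

lemma rot_facts:
  fixes \<sigma> :: complex
  defines "D \<equiv> (\<lambda>z. p - \<sigma> * p + \<sigma> * z) -` (slit p n \<union> {z. d < norm (z - p)})"
  defines "f \<equiv> \<lambda>z. u (p - \<sigma> * p + \<sigma> * z)"
  assumes \<sigma>: "norm \<sigma> = 1" and V: "open V" "\<And>z. z \<in> V \<Longrightarrow> norm (z - p) < e \<Longrightarrow> p - \<sigma> * p + \<sigma> * z \<in> slit p n"
  shows rot_dom: "open D" "V \<subseteq> D"
    and rot_Cinf: "Cinf_on D f"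
    and rot_L2: "\<And>vs. length vs \<le> 1 \<Longrightarrow> L2 V (ddl vs f)"
proof -
  note R = bounded_linear_mult_right[of \<sigma>]
  have nR: "norm (p - \<sigma> * p + \<sigma> * z - p) = norm (z - p)" for z
  proof -
    have "p - \<sigma> * p + \<sigma> * z - p = \<sigma> * (z - p)" by (simp add: algebra_simps)
    then show ?thesis using \<sigma> by (simp add: norm_mult)
  qed
  show D: "open D" unfolding D_def by (intro open_vimage open_dom continuous_intros)
  show VD: "V \<subseteq> D"
  proof
    fix z assume z: "z \<in> V"
    show "z \<in> D"
    proof (cases "norm (z - p) < e")
      case True
      then show ?thesis using V(2)[OF z] by (simp add: D_def)
    next
      case False
      then show ?thesis using de nR[of z] by (simp add: D_def)
    qed
  qed
  show f: "Cinf_on D f" unfolding D_def f_def by (rule Cinf_on_affine[OF open_dom Cinf_u R])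
  have df: "ddl vs f z = ddl (map ((*) \<sigma>) vs) u (p - \<sigma> * p + \<sigma> * z)" if "z \<in> V" for vs z
    unfolding f_def using VD that by (intro ddl_affine[OF open_dom Cinf_u R]) (auto simp: D_def)
  fix vs :: "complex list" assume l: "length vs \<le> 1"
  obtain C where C: "\<And>z. z \<in> S \<Longrightarrow> \<bar>ddl (map ((*) \<sigma>) vs) u z\<bar> \<le> C * norm (z - p) powr (\<mu> - length (map ((*) \<sigma>) vs))"
    using ddl_u_bound by blast
  show "L2 V (ddl vs f)"
  proof (rule L2_powr_bound[OF V(1)])
    show "continuous_on V (ddl vs f)" using Cinf_on_continuous[OF f] VD continuous_on_subset by blast
    show "-1 < \<mu> - 1" "\<mu> - 1 \<le> 0" using \<mu> by auto
    show "ddl vs f z = 0" if "z \<in> V" "norm (z - p) \<ge> 1" for z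
      unfolding df[OF that(1)] using nR[of z] that(2) de by (intro ddl_u_zero) simp
    show "\<bar>ddl vs f z\<bar> \<le> \<bar>C\<bar> * norm (z - p) powr (\<mu> - 1)" if z: "z \<in> V" "norm (z - p) < 1" for z
    proof (cases "norm (z - p) < e")
      case True
      then have "p - \<sigma> * p + \<sigma> * z \<in> S" using V(2)[OF z(1)] nR[of z]
        by (simp add: S_def dist_norm norm_minus_commute)
      from C[OF this] have "\<bar>ddl vs f z\<bar> \<le> C * norm (z - p) powr (\<mu> - length vs)"
        unfolding df[OF z(1)] nR by simp
      also have "\<dots> \<le> \<bar>C\<bar> * norm (z - p) powr (\<mu> - 1)"
        using l z(2) by (intro mult_mono powr_mono') auto
      finally show ?thesis .
    next
      case False
      then have "ddl vs f z = 0" unfolding df[OF z(1)] using nR[of z] de by (intro ddl_u_zero) simp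
      then show ?thesis by simp
    qed
  qed
qed

text \<open>Supplies the bound that makes the traces square integrable in the curve
  parameter.\<close>

lemma u_bounded:
  obtains M where "\<And>z. (norm (z - p) < e \<Longrightarrow> z \<in> slit p n) \<Longrightarrow> \<bar>u z\<bar> \<le> M"
proof -
  obtain C where C: "\<And>z. z \<in> S \<Longrightarrow> \<bar>u z\<bar> \<le> C * norm (z - p) powr \<mu>"
    using ddl_u_bound[of "[]"] by auto
  have "\<bar>u z\<bar> \<le> \<bar>C\<bar>" if "norm (z - p) < e \<Longrightarrow> z \<in> slit p n" for z
  proof (cases "norm (z - p) < e")
    case True
    then have z: "z \<in> S" using that by (simp add: S_def dist_norm norm_minus_commute)
    have "norm (z - p) powr \<mu> \<le> 1" using True de \<mu> by (intro powr_le1) auto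
    then have "C * norm (z - p) powr \<mu> \<le> \<bar>C\<bar> * 1" by (intro mult_mono) auto
    then show ?thesis using C[OF z] by simp
  next
    case False
    then show ?thesis using u_zero[of z] de by simp
  qed
  then show ?thesis using that by blast
qed

lemma L2_lap:
  assumes G: "open G" and sl: "\<And>z. z \<in> G \<Longrightarrow> norm (z - p) < e \<Longrightarrow> z \<in> slit p n"
  shows "L2 G (lap u)"
proof -
  have sub: "G \<subseteq> slit p n \<union> {z. d < norm (z - p)}" using sl de by force
  obtain C1 where C1: "\<And>z. z \<in> S \<Longrightarrow> \<bar>ddl [1, 1] v z\<bar> \<le> C1 * norm (z - p) powr (\<mu> + 1 - length [1::complex, 1])"
    using ddl_v_bound by blast
  obtain C2 where C2: "\<And>z. z \<in> S \<Longrightarrow> \<bar>ddl [\<i>, \<i>] v z\<bar> \<le> C2 * norm (z - p) powr (\<mu> + 1 - length [\<i>, \<i>])"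
    using ddl_v_bound by blast
  have lap0: "lap u z = 0" if "d < norm (z - p)" for z
    unfolding lap_def using ddl_u_zero[OF that] by (simp del: ddl.simps)
  show ?thesis
  proof (rule L2_powr_bound[OF G])
    show "continuous_on G (lap u)" unfolding lap_def[abs_def]
      using Cinf_on_continuous[OF Cinf_on_subset[OF Cinf_u sub]] by (intro continuous_on_add) blast+
    show "-1 < \<mu> - 1" "\<mu> - 1 \<le> 0" using \<mu> by auto
    show "lap u z = 0" if "z \<in> G" "norm (z - p) \<ge> 1" for z
      using lap0 that de by simp
    show "\<bar>lap u z\<bar> \<le> (\<bar>C1\<bar> + \<bar>C2\<bar>) * norm (z - p) powr (\<mu> - 1)" if z: "z \<in> G" "norm (z - p) < 1" for z
    proof (cases "norm (z - p) < e")
      case True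
      then have "z \<in> S" using sl[OF z(1)] by (simp add: S_def dist_norm norm_minus_commute)
      then have "\<bar>lap u z\<bar> \<le> C1 * norm (z - p) powr (\<mu> - 1) + C2 * norm (z - p) powr (\<mu> - 1)"
        unfolding lap_u_eq[OF \<open>z \<in> S\<close>] using C1[of z] C2[of z] by (simp del: ddl.simps)
      also have "\<dots> \<le> (\<bar>C1\<bar> + \<bar>C2\<bar>) * norm (z - p) powr (\<mu> - 1)"
        by (simp add: distrib_right add_mono mult_right_mono)
      finally show ?thesis .
    next
      case False
      then show ?thesis using lap0[of z] de by simp
    qed
  qed
qed

end

section \<open>Failure of second-order regularity\<close>

lemma weak_derivD:
  "weak_deriv G v f g \<Longrightarrow> test_fn G \<phi> \<Longrightarrow> integral\<^sup>L (lebesgue_on G) (\<lambda>z. g z * \<phi> z)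
     = - integral\<^sup>L (lebesgue_on G) (\<lambda>z. f z * ddl [v] \<phi> z)"
  unfolding weak_deriv_def by simp

text \<open>Provides a ray in the open half-plane on which the leading second derivative does not
  vanish. If \<open>Re c = 0\<close>, the ray at angle one radian works: there the real part is
  \<open>- Im c * sin a\<close>, and \<open>-2 < a < -1\<close> keeps the sine nonzero.\<close>

lemma exists_unit_Re_powr_nonzero:
  assumes "c \<noteq> 0" "-2 < a" "a < -1"
  obtains w where "norm w = 1" "Re w > 0" "Re (c * w powr of_real a) \<noteq> 0"
proof (cases "Re c = 0")
  case False
  then show ?thesis using that[of 1] by simp
next
  case True
  then have c: "Im c \<noteq> 0" using assms(1) by (simp add: complex_eq_iff)
  have "Ln (cis 1) = \<i>" using Ln_exp[of \<i>] pi_gt3 by (simp add: cis_conv_exp)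
  then have "cis 1 powr of_real a = cis a" by (simp add: powr_def cis_conv_exp mult.commute)
  moreover have "sin (- a) > 0" using assms pi_gt3 by (intro sin_gt_zero) auto
  moreover have "cos 1 > (0::real)" using pi_gt3 by (intro cos_gt_zero_pi) auto
  ultimately show ?thesis using that[of "cis 1"] c True by simp
qed

context corner_function
begin

text \<open>Against test functions a second weak derivative \<open>w'\<close> has the same integrals
  as the classical \<open>ddl [1, 1] u\<close>. For a bump of radius
  \<open>\<kappa> * \<rho>\<close> at distance \<open>\<rho>\<close> from \<open>p\<close> this
  integral is at least of order \<open>\<rho>^(\<mu>-2) * \<rho>^2 = \<rho>^\<mu>\<close>, whereas
  \<open>w'\<close> in L2 makes it at most of order \<open>\<rho>\<close>. As
  \<open>\<mu> < 1\<close>, small \<open>\<rho>\<close> give a contradiction.\<close>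

lemma not_W2:
  assumes G: "open G" and half: "G \<inter> ball p e = halfplane p n \<inter> ball p e"
    and c0: "c0 \<noteq> 0"
  shows "\<not> W2 G u"
proof
  assume "W2 G u"
  then obtain w where w: "W1 G w" "weak_deriv G 1 u w" by (auto simp: W2_def)
  then obtain w' where w': "L2 G w'" "weak_deriv G 1 w w'" by (auto simp: W1_def)
  note halfeq = halfplane_unit[OF n, of p] and half_slit = halfplane_subset_slit[OF n, of p]
  have inG: "z \<in> G \<and> z \<in> S" if "Re ((z - p) / n) > 0" "norm (z - p) < e" for z
    using half half_slit that unfolding S_def halfeq by (auto simp: dist_norm norm_minus_commute)
  have "G \<inter> ball p e \<subseteq> slit p n" using half half_slit by blast
  then have sub: "G \<subseteq> slit p n \<union> {z. d < norm (z - p)}"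
    using de by (force simp: dist_norm norm_minus_commute)
  have uG: "Cinf_on G u" by (rule Cinf_on_subset[OF Cinf_u sub])
  \<comment> \<open>Both sides are moved onto the second derivative of \<open>\<phi>\<close>, where
    only \<open>u\<close> itself remains.\<close>
  have test: "integral\<^sup>L (lebesgue_on G) (\<lambda>z. ddl [1, 1] u z * \<phi> z) = integral\<^sup>L (lebesgue_on G) (\<lambda>z. w' z * \<phi> z)"
    if t: "test_fn G \<phi>" for \<phi>
  proof -
    have "integral\<^sup>L (lebesgue_on G) (\<lambda>z. ddl [1] (ddl [1] u) z * \<phi> z)
        = - integral\<^sup>L (lebesgue_on G) (\<lambda>z. ddl [1] u z * ddl [1] \<phi> z)"
      by (rule weak_derivD[OF Cinf_imp_weak_deriv[OF G Cinf_on_ddl[OF uG]] t])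
    also have "\<dots> = integral\<^sup>L (lebesgue_on G) (\<lambda>z. u z * ddl [1] (ddl [1] \<phi>) z)"
      by (simp only: weak_derivD[OF Cinf_imp_weak_deriv[OF G uG] test_fn_ddl[OF t]] minus_minus)
    also have "\<dots> = - integral\<^sup>L (lebesgue_on G) (\<lambda>z. w z * ddl [1] \<phi> z)"
      by (simp only: weak_derivD[OF w(2) test_fn_ddl[OF t]] minus_minus)
    also have "\<dots> = integral\<^sup>L (lebesgue_on G) (\<lambda>z. w' z * \<phi> z)"
      by (simp only: weak_derivD[OF w'(2) t])
    finally show ?thesis by simp
  qed
  \<comment> \<open>Coefficient of the leading power in \<open>ddl [1, 1] u\<close>, as given by
    \<open>ddl_u_eq\<close> in direction 1.\<close>
  define c where "c = c0 * of_real \<mu> / n * 1 * of_real (\<mu> - 1) / n * 1"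
  have n0: "n \<noteq> 0" using n by auto
  have "of_real (\<mu> - 1) \<noteq> (0::complex)" using \<mu> by (simp only: of_real_eq_0_iff)
  then have "c \<noteq> 0" using c0 n0 \<mu> by (simp add: c_def del: of_real_diff)
  then obtain w0 where w0: "norm w0 = 1" "Re w0 > 0" "Re (c * w0 powr of_real (\<mu> - 2)) \<noteq> 0"
    using exists_unit_Re_powr_nonzero[of c "\<mu> - 2"] \<mu> by auto
  \<comment> \<open>\<open>s\<close> makes the leading term positive at \<open>w0\<close>; halving
    its modulus leaves a neighbourhood of \<open>w0\<close> where \<open>g > m\<close>.\<close>
  define s where "s = sgn (Re (c * w0 powr of_real (\<mu> - 2)))"
  define m where "m = \<bar>Re (c * w0 powr of_real (\<mu> - 2))\<bar> / 2"
  have s: "\<bar>s\<bar> = 1" and m: "m > 0" using w0 by (auto simp: s_def m_def sgn_if)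
  define g where "g x = s * Re (c * x powr of_real (\<mu> - 2))" for x
  have "isCont (\<lambda>x. x powr of_real (\<mu> - 2)) w0"
    using w0(2) by (intro isCont_powr_complex continuous_ident continuous_const) (auto elim!: nonpos_Reals_cases)
  then have "isCont g w0"
    unfolding g_def by (intro continuous_mult continuous_const continuous_Re)
  moreover have "g w0 > m" using w0 by (auto simp: g_def s_def m_def sgn_if)
  ultimately have "\<forall>\<^sub>F x in nhds w0. g x > m"
    using order_tendstoD(1) isCont_def tendsto_at_iff_tendsto_nhds by metis
  moreover have "\<forall>\<^sub>F x in nhds w0. Re x > 0"
    using w0(2) by (intro order_tendstoD(1)[OF tendsto_Re[OF filterlim_ident]])
  ultimately have "\<forall>\<^sub>F x in nhds w0. g x > m \<and> Re x > 0" by (rule eventually_conj)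
  then obtain \<kappa>0 where \<kappa>0: "\<kappa>0 > 0" "\<And>x. dist x w0 < \<kappa>0 \<Longrightarrow> g x > m \<and> Re x > 0"
    unfolding eventually_nhds_metric by blast
  \<comment> \<open>\<open>\<kappa> < \<kappa>0\<close> preserves \<open>g > m\<close> on the
    rescaled disc; \<open>\<kappa> \<le> 1/2\<close> keeps that disc between the radii 1/2 and
    3/2.\<close>
  define \<kappa> where "\<kappa> = min (\<kappa>0 / 2) (1 / 2)"
  have \<kappa>: "0 < \<kappa>" "\<kappa> \<le> 1/2" "\<kappa> < \<kappa>0" using \<kappa>0 by (auto simp: \<kappa>_def)
  obtain C where C: "\<And>z. z \<in> S \<Longrightarrow> \<bar>ddl [1, 1] v z\<bar> \<le> C * norm (z - p) powr (\<mu> + 1 - length [1::complex, 1])"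
    using ddl_v_bound by blast
  \<comment> \<open>At distance at least \<open>\<rho> / 2\<close> from \<open>p\<close> the
    remainder is at most \<open>\<rho> powr (\<mu> - 2) * (C' * \<rho>)\<close>, one order below the
    leading term.\<close>
  define C' where "C' = \<bar>C\<bar> * (1/2) powr (\<mu> - 1)"
  define W where "W = integral\<^sup>L (lebesgue_on G) (\<lambda>z. (w' z)\<^sup>2)"
  define \<eta> where "\<eta> = flat 1 (3/4)"
  have \<eta>: "\<eta> > 0" by (simp add: \<eta>_def flat_def)
  \<comment> \<open>Left: a lower bound of the second derivative, times the lower bound
    \<open>\<eta>\<close> of the bump, times the area of the half-radius disc. Right: an upper bound
    from Young's inequality.\<close>
  have key: "\<rho> powr (\<mu> - 2) * (m - C' * \<rho>) * \<eta> * (unit_ball_vol 2 * (\<kappa> * \<rho> / 2)\<^sup>2)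
      \<le> \<rho> * (W + unit_ball_vol 2 * \<kappa>\<^sup>2) / 2"
    if \<rho>: "0 < \<rho>" "\<rho> < e / 2" "m - C' * \<rho> \<ge> 0" for \<rho>
  proof -
    define z0 where "z0 = p + n * of_real \<rho> * w0"
    define \<phi> where "\<phi> = bump z0 (\<kappa> * \<rho>)"
    have kr: "\<kappa> * \<rho> > 0" using \<kappa> \<rho> by simp
    have loc: "z \<in> G \<and> z \<in> S \<and> s * ddl [1, 1] u z \<ge> \<rho> powr (\<mu> - 2) * (m - C' * \<rho>)"
      if z: "z \<in> cball z0 (\<kappa> * \<rho>)" for z
    proof -
      \<comment> \<open>The coordinate rescaled by \<open>\<rho>\<close>: \<open>z0\<close> becomes
        \<open>w0\<close>, and homogeneity pulls out \<open>\<rho> powr (\<mu> - 2)\<close>.\<close>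
      define x where "x = (z - p) / n / of_real \<rho>"
      have zx: "(z - p) / n = of_real \<rho> * x" using \<rho> by (simp add: x_def)
      have "x - w0 = (z - z0) / (n * of_real \<rho>)"
        using n0 \<rho> by (simp add: x_def z0_def field_simps)
      then have "norm (x - w0) = norm (z - z0) / \<rho>"
        using n \<rho> by (simp add: norm_divide norm_mult)
      also have "\<dots> \<le> \<kappa>" using z \<rho> by (simp add: dist_norm norm_minus_commute divide_le_eq)
      finally have xw: "norm (x - w0) \<le> \<kappa>" .
      then have gx: "g x > m" "Re x > 0" using \<kappa>0(2)[of x] \<kappa> by (auto simp: dist_norm)
      have nx: "1/2 \<le> norm x" "norm x \<le> 3/2"
        using xw \<kappa> w0(1) norm_triangle_ineq2[of w0 x] norm_triangle_ineq2[of x w0]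
        by (auto simp: norm_minus_commute)
      have nz: "norm (z - p) = \<rho> * norm x"
        using arg_cong[OF zx, of norm] n \<rho> by (simp add: norm_divide norm_mult)
      have "Re ((z - p) / n) > 0" using gx \<rho> by (simp add: zx)
      moreover have "norm (z - p) < e"
      proof -
        have "\<rho> * norm x \<le> \<rho> * (3/2)" using nx \<rho> by (intro mult_left_mono) auto
        then show ?thesis unfolding nz using \<rho>(1,2) by linarith
      qed
      ultimately have zS: "z \<in> G \<and> z \<in> S" by (rule inG)
      have x0: "x \<noteq> 0" using gx by auto
      have "(of_real \<rho> * x) powr of_real (\<mu> - 2) = of_real (\<rho> powr (\<mu> - 2)) * x powr of_real (\<mu> - 2)"
        using x0 \<rho> by (simp add: powr_def Ln_times_of_real exp_add distrib_left Ln_of_real flip: exp_of_real)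
      then have "s * re_powr p n c (\<mu> - 2) z = \<rho> powr (\<mu> - 2) * g x"
        by (simp add: re_powr_def zx g_def algebra_simps)
      then have A: "s * re_powr p n c (\<mu> - 2) z \<ge> \<rho> powr (\<mu> - 2) * m"
        using gx by (simp add: mult_left_mono)
      have "\<bar>ddl [1, 1] v z\<bar> \<le> \<bar>C\<bar> * norm (z - p) powr (\<mu> - 1)"
        using C[of z] zS order_trans[OF _ mult_right_mono[OF abs_ge_self, of "norm (z - p) powr (\<mu> - 1)" C]]
        by (simp del: ddl.simps)
      also have "\<dots> \<le> \<bar>C\<bar> * (\<rho> * (1/2)) powr (\<mu> - 1)"
        unfolding nz using \<mu> \<rho> nx by (intro mult_left_mono powr_mono2') auto
      also have "(\<rho> * (1/2)) powr (\<mu> - 1) = \<rho> powr (\<mu> - 2) * \<rho> * (1/2) powr (\<mu> - 1)"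
        using \<rho>(1) powr_add[of \<rho> "\<mu> - 2" 1] by (subst powr_mult) simp_all
      finally have "\<bar>s * ddl [1, 1] v z\<bar> \<le> \<rho> powr (\<mu> - 2) * (C' * \<rho>)"
        using s by (simp add: C'_def abs_mult mult_ac mult_left_mono del: ddl.simps)
      then have B: "s * ddl [1, 1] v z \<ge> - (\<rho> powr (\<mu> - 2) * (C' * \<rho>))" by linarith
      have "ddl [1, 1] u z = re_powr p n c (\<mu> - 2) z + ddl [1, 1] v z"
        using ddl_u_eq[of z 1] zS unfolding c_def by blast
      then have "s * ddl [1, 1] u z = s * re_powr p n c (\<mu> - 2) z + s * ddl [1, 1] v z"
        by (simp only: distrib_left)
      with A B have "s * ddl [1, 1] u z \<ge> \<rho> powr (\<mu> - 2) * (m - C' * \<rho>)"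
        unfolding right_diff_distrib by linarith
      with zS show ?thesis by blast
    qed
    have t: "test_fn G \<phi>"
      unfolding \<phi>_def using loc by (intro test_fn_bump kr) blast
    have G': "G \<inter> space lebesgue \<in> sets lebesgue" using G by simp
    have ind: "integrable (lebesgue_on G) (\<lambda>z. indicat_real (cball z0 r) z)"
      and int_ind: "integral\<^sup>L (lebesgue_on G) (\<lambda>z. indicat_real (cball z0 r) z) = unit_ball_vol 2 * r\<^sup>2"
      if r: "0 \<le> r" "cball z0 r \<subseteq> G" for r
    proof -
      have mm: "measure (lebesgue_on G) (cball z0 r) = unit_ball_vol 2 * r\<^sup>2"
        using r content_cball[of r z0] by (subst measure_restrict_space[OF G']) auto
      show "integral\<^sup>L (lebesgue_on G) (\<lambda>z. indicat_real (cball z0 r) z) = unit_ball_vol 2 * r\<^sup>2"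
        using mm r by (simp add: Int_absorb2 space_restrict_space)
      have "emeasure (lebesgue_on G) (cball z0 r) < \<infinity>"
        using r emeasure_lborel_cball_finite[of z0 r] by (subst emeasure_restrict_space[OF G']) auto
      moreover have "cball z0 r \<in> sets (lebesgue_on G)"
        using r by (subst sets_restrict_space_iff[OF G']) auto
      ultimately show "integrable (lebesgue_on G) (\<lambda>z. indicat_real (cball z0 r) z)"
        by (intro integrable_real_indicator)
    qed
    have sub2: "cball z0 (\<kappa> * \<rho>) \<subseteq> G" "cball z0 (\<kappa> * \<rho> / 2) \<subseteq> G" 
      using loc kr by (auto simp: subset_iff)
    have "\<rho> powr (\<mu> - 2) * (m - C' * \<rho>) * \<eta> * (unit_ball_vol 2 * (\<kappa> * \<rho> / 2)\<^sup>2)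
      = integral\<^sup>L (lebesgue_on G) (\<lambda>z. \<rho> powr (\<mu> - 2) * (m - C' * \<rho>) * \<eta> * indicator (cball z0 (\<kappa> * \<rho> / 2)) z)"
      using int_ind[OF _ sub2(2)] kr by simp
    also have "\<dots> \<le> integral\<^sup>L (lebesgue_on G) (\<lambda>z. s * (ddl [1, 1] u z * \<phi> z))"
    proof (rule integral_mono)
      show "integrable (lebesgue_on G) (\<lambda>z. \<rho> powr (\<mu> - 2) * (m - C' * \<rho>) * \<eta> * indicator (cball z0 (\<kappa> * \<rho> / 2)) z)"
        using ind[OF _ sub2(2)] kr by (intro integrable_mult_right) auto
      show "integrable (lebesgue_on G) (\<lambda>z. s * (ddl [1, 1] u z * \<phi> z))"
        by (intro integrable_mult_right integrable_test_fn G t Cinf_on_continuous uG)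
      fix z
      show "\<rho> powr (\<mu> - 2) * (m - C' * \<rho>) * \<eta> * indicator (cball z0 (\<kappa> * \<rho> / 2)) z \<le> s * (ddl [1, 1] u z * \<phi> z)"
      proof (cases "z \<in> cball z0 (\<kappa> * \<rho>)")
        case True
        have ip: "\<eta> * indicator (cball z0 (\<kappa> * \<rho> / 2)) z \<le> \<phi> z"
          using bump_ge[OF kr, of z z0] bump_bounds[of z0 "\<kappa> * \<rho>" z]
          by (auto simp: \<phi>_def \<eta>_def indicator_def dist_norm norm_minus_commute)
        have "(\<rho> powr (\<mu> - 2) * (m - C' * \<rho>)) * (\<eta> * indicator (cball z0 (\<kappa> * \<rho> / 2)) z) \<le> (s * ddl [1, 1] u z) * \<phi> z"
        proof (rule mult_mono[OF conjunct2[OF conjunct2[OF loc[OF True]]] ip])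
          show "0 \<le> s * ddl [1, 1] u z"
            by (rule order_trans[OF _ conjunct2[OF conjunct2[OF loc[OF True]]]]) (use \<rho>(3) in simp)
        qed (use \<eta> in auto)
        then show ?thesis by (simp only: mult.assoc)
      next
        case False
        then have "z \<notin> cball z0 (\<kappa> * \<rho> / 2)" "\<phi> z = 0"
          using kr by (auto simp: \<phi>_def bump_eq_0_iff dist_norm norm_minus_commute)
        then show ?thesis by simp
      qed
    qed
    also have "\<dots> = s * integral\<^sup>L (lebesgue_on G) (\<lambda>z. w' z * \<phi> z)"
      by (simp only: integral_mult_right_zero test[OF t])
    also have "\<dots> \<le> \<bar>integral\<^sup>L (lebesgue_on G) (\<lambda>z. w' z * \<phi> z)\<bar>"
      using s by (metis abs_ge_self abs_mult mult_1)
    \<comment> \<open>Young's inequality with weight \<open>\<rho>\<close>: the disc has area of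
      order \<open>\<rho>^2\<close>, so division by \<open>\<rho>\<close> makes both terms of order
      \<open>\<rho>\<close>.\<close>
    also have "\<dots> \<le> integral\<^sup>L (lebesgue_on G) (\<lambda>z. \<rho> / 2 * (w' z)\<^sup>2 + 1 / (2 * \<rho>) * indicator (cball z0 (\<kappa> * \<rho>)) z)"
    proof -
      let ?M = "\<lambda>z. \<rho> / 2 * (w' z)\<^sup>2 + 1 / (2 * \<rho>) * indicator (cball z0 (\<kappa> * \<rho>)) z"
      have M: "integrable (lebesgue_on G) ?M"
        using w'(1) ind[OF _ sub2(1)] kr unfolding L2_def by (intro integrable_mult_right Bochner_Integration.integrable_add) auto
      have bd: "\<bar>w' z * \<phi> z\<bar> \<le> ?M z" for z
      proof (cases "z \<in> cball z0 (\<kappa> * \<rho>)")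
        case True
        have "0 \<le> (\<rho> * \<bar>w' z\<bar> - \<phi> z)\<^sup>2 / (2 * \<rho>)" using \<rho> by simp
        also have "\<dots> = \<rho> / 2 * (w' z)\<^sup>2 + (\<phi> z)\<^sup>2 / (2 * \<rho>) - \<bar>w' z\<bar> * \<phi> z"
          using \<rho> by (simp add: power2_eq_square field_simps)
        finally have "\<bar>w' z\<bar> * \<phi> z \<le> \<rho> / 2 * (w' z)\<^sup>2 + (\<phi> z)\<^sup>2 / (2 * \<rho>)" by simp
        moreover have "(\<phi> z)\<^sup>2 \<le> 1"
          using bump_bounds[of z0 "\<kappa> * \<rho>" z] by (auto simp: \<phi>_def intro: power_le_one)
        then have "(\<phi> z)\<^sup>2 / (2 * \<rho>) \<le> 1 / (2 * \<rho>)" using \<rho> by (simp add: divide_right_mono)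
        moreover have "\<bar>\<phi> z\<bar> = \<phi> z" using bump_bounds by (simp add: \<phi>_def)
        ultimately show ?thesis using True by (simp add: abs_mult)
      next
        case False
        then have "\<phi> z = 0"
          using kr by (auto simp: \<phi>_def bump_eq_0_iff dist_norm norm_minus_commute)
        then show ?thesis using \<rho> by simp
      qed
      have "\<phi> \<in> borel_measurable (lebesgue_on G)"
        using Cinf_on_continuous[OF Cinf_on_bump[of G z0 "\<kappa> * \<rho>"], of "[]"] G
        by (intro continuous_imp_measurable_on_sets_lebesgue) (auto simp: \<phi>_def)
      then have "(\<lambda>z. w' z * \<phi> z) \<in> borel_measurable (lebesgue_on G)"
        using w'(1) unfolding L2_def by (intro borel_measurable_times) auto
      then have "integrable (lebesgue_on G) (\<lambda>z. w' z * \<phi> z)"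
        by (rule Bochner_Integration.integrable_bound[OF M])
          (use bd in \<open>auto intro: order_trans[OF _ abs_ge_self]\<close>)
      then show ?thesis using bd by (intro integral_abs_bound_integral M)
    qed
    also have "\<dots> = \<rho> / 2 * W + 1 / (2 * \<rho>) * (unit_ball_vol 2 * (\<kappa> * \<rho>)\<^sup>2)"
      using w'(1) ind[OF _ sub2(1)] int_ind[OF _ sub2(1)] kr unfolding L2_def W_def
      by (subst Bochner_Integration.integral_add) (auto simp del: Bochner_Integration.integral_indicator)
    also have "\<dots> = \<rho> * (W + unit_ball_vol 2 * \<kappa>\<^sup>2) / 2"
      using \<rho> by (simp add: power2_eq_square field_simps)
    finally show ?thesis .
  qed
  define K1 where "K1 = m / 2 * \<eta> * unit_ball_vol 2 * (\<kappa> / 2)\<^sup>2"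
  define K2 where "K2 = (W + unit_ball_vol 2 * \<kappa>\<^sup>2) / 2"
  have K1: "K1 > 0" using m \<eta> \<kappa> by (simp add: K1_def)
  have small: "\<forall>\<^sub>F \<rho> in at_right 0. 0 < \<rho> \<and> \<rho> < e / 2 \<and> m - C' * \<rho> > m / 2"
  proof -
    have "((\<lambda>\<rho>. m - C' * \<rho>) \<longlongrightarrow> m - C' * 0) (at_right 0)" by (intro tendsto_intros)
    then have "\<forall>\<^sub>F \<rho> in at_right 0. m - C' * \<rho> > m / 2" using m by (intro order_tendstoD(1)) auto
    moreover have "\<forall>\<^sub>F \<rho> in at_right 0. \<rho> < e / 2" using de by (intro eventually_at_right_real[of 0 "e/2", THEN eventually_mono]) auto
    ultimately show ?thesis using eventually_at_right_less[of 0] by eventually_elim auto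
  qed
  have "filterlim (\<lambda>\<rho>::real. \<rho> powr (1 - \<mu>)) (at_right 0) (at_right 0)"
    unfolding filterlim_at using \<mu>
    by (auto intro!: tendsto_eq_intros eventually_mono[OF eventually_at_right_less[of 0]] simp: eventually_conj_iff)
  then have "\<forall>\<^sub>F \<rho> in at_right 0. \<rho> powr (1 - \<mu>) * (\<bar>K2\<bar> + 1) < K1"
  proof -
    have "((\<lambda>\<rho>::real. \<rho> powr (1 - \<mu>) * (\<bar>K2\<bar> + 1)) \<longlongrightarrow> 0 * (\<bar>K2\<bar> + 1)) (at_right 0)"
      using \<mu> by (intro tendsto_intros) (auto intro!: tendsto_eq_intros eventually_mono[OF eventually_at_right_less[of 0]])
    then show ?thesis using K1 by (intro order_tendstoD(2)) auto
  qed
  then obtain \<rho> where \<rho>: "0 < \<rho>" "\<rho> < e / 2" "m - C' * \<rho> > m / 2" "\<rho> powr (1 - \<mu>) * (\<bar>K2\<bar> + 1) < K1"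
    using eventually_happens[OF eventually_conj[OF small]] by (auto simp: trivial_limit_at_right_real)
  \<comment> \<open>With \<open>m - C' * \<rho> > m / 2\<close>, \<open>key\<close> implies
    \<open>\<rho>^\<mu> * K1 \<le> \<rho> * K2\<close>, which the choice of \<open>\<rho>\<close>
    violates.\<close>
  have "\<rho> powr \<mu> * K1 = \<rho> powr (\<mu> - 2) * (m / 2) * \<eta> * (unit_ball_vol 2 * (\<kappa> * \<rho> / 2)\<^sup>2)"
    using \<rho>(1) powr_add[of \<rho> "\<mu> - 2" 2] by (simp add: K1_def power2_eq_square powr_numeral field_simps)
  also have "\<dots> \<le> \<rho> powr (\<mu> - 2) * (m - C' * \<rho>) * \<eta> * (unit_ball_vol 2 * (\<kappa> * \<rho> / 2)\<^sup>2)"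
    using \<rho> \<eta> by (intro mult_right_mono mult_left_mono) auto
  also have "\<dots> \<le> \<rho> * K2"
    using key[of \<rho>] \<rho> m by (simp add: K2_def)
  also have "\<dots> \<le> \<rho> * (\<bar>K2\<bar> + 1)" using \<rho> by (intro mult_left_mono) auto
  also have "\<dots> = \<rho> powr \<mu> * (\<rho> powr (1 - \<mu>) * (\<bar>K2\<bar> + 1))"
    using \<rho>(1) powr_add[of \<rho> \<mu> "1 - \<mu>"] by (simp add: mult.assoc)
  also have "\<dots> < \<rho> powr \<mu> * K1" using \<rho> by simp
  finally show False by simp
qed

end

section \<open>Traces and nonlocal conditions\<close>

lemma L2_cong:
  assumes "\<And>z. z \<in> V \<Longrightarrow> f z = g z" "L2 V f" shows "L2 V g"
proof -
  have "f \<in> borel_measurable (lebesgue_on V) \<longleftrightarrow> g \<in> borel_measurable (lebesgue_on V)"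
    by (rule measurable_cong) (use assms(1) in \<open>simp add: space_restrict_space\<close>)
  moreover have "integrable (lebesgue_on V) (\<lambda>z. (f z)\<^sup>2) \<longleftrightarrow> integrable (lebesgue_on V) (\<lambda>z. (g z)\<^sup>2)"
    by (rule Bochner_Integration.integrable_cong) (use assms(1) in \<open>simp_all add: space_restrict_space\<close>)
  ultimately show ?thesis using assms(2) by (simp add: L2_def)
qed

lemma L2_zero: "L2 V (\<lambda>_. 0)"
  by (simp add: L2_def)

lemma weak_deriv_cong:
  assumes "\<And>z. z \<in> V \<Longrightarrow> f z = g z" "weak_deriv V v f w" shows "weak_deriv V v g w"
proof -
  have "integral\<^sup>L (lebesgue_on V) (\<lambda>z. f z * ddl [v] \<phi> z) = integral\<^sup>L (lebesgue_on V) (\<lambda>z. g z * ddl [v] \<phi> z)" for \<phi>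
    by (rule Bochner_Integration.integral_cong) (use assms(1) in \<open>simp_all add: space_restrict_space\<close>)
  then show ?thesis using assms(2) by (simp only: weak_deriv_def)
qed

text \<open>The constant sequence \<open>f\<close> serves as approximation, being smooth past the
  curve. The separate \<open>g\<close> only has to agree with \<open>f\<close> on \<open>V\<close>:
  it will be a composite \<open>u \<circ> F\<close>, and \<open>f\<close> a rotated \<open>u\<close>
  or zero, smooth on a larger open set.\<close>

lemma trace_rel_smooth:
  assumes V: "open V" and U: "open U" "V \<union> \<gamma> ` {0<..<1} \<subseteq> U" and f: "Cinf_on U f"
    and L: "L2 V f" "L2 V (ddl [1] f)" "L2 V (ddl [\<i>] f)"
    and g: "\<And>z. z \<in> V \<Longrightarrow> g z = f z"
    and \<gamma>: "continuous_on {0<..<1} \<gamma>" and M: "\<And>t. t \<in> {0<..<1} \<Longrightarrow> \<bar>f (\<gamma> t)\<bar> \<le> M"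
  shows "trace_rel V \<gamma> g (\<lambda>t. f (\<gamma> t))"
proof -
  have fV: "Cinf_on V f" using f U(2) by (auto intro: Cinf_on_subset)
  have wd: "weak_deriv V v g (ddl [v] f)" for v
    by (rule weak_deriv_cong[OF _ Cinf_imp_weak_deriv[OF V fV]]) (simp add: g)
  have z: "L2 W (\<lambda>z. h z - h z)" for h :: "'a::euclidean_space \<Rightarrow> real" and W
    by (simp add: L2_zero)
  have Lg: "L2 V g" by (rule L2_cong[OF _ L(1)]) (simp add: g)
  have Ld: "L2 V (\<lambda>z. f z - g z)" by (rule L2_cong[OF _ L2_zero]) (simp add: g)
  have i0: "integral\<^sup>L (lebesgue_on V) (\<lambda>z. (f z - g z)\<^sup>2) = 0"
  proof -
    have "integral\<^sup>L (lebesgue_on V) (\<lambda>z. (f z - g z)\<^sup>2) = integral\<^sup>L (lebesgue_on V) (\<lambda>z. 0)"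
      by (rule Bochner_Integration.integral_cong) (use g in \<open>simp_all add: space_restrict_space\<close>)
    then show ?thesis by simp
  qed
  have Lt: "L2 {0<..<1} (\<lambda>t. f (\<gamma> t))"
  proof (rule L2_bound[where w="\<lambda>t. M\<^sup>2 * indicator {0<..<1} t"])
    show "continuous_on {0<..<1} (\<lambda>t. f (\<gamma> t))"
      using Cinf_on_continuous[OF f, of "[]"] \<gamma> U(2) by (auto intro: continuous_on_compose2)
    show "(f (\<gamma> t))\<^sup>2 \<le> M\<^sup>2 * indicator {0<..<1} t" if "t \<in> {0<..<1}" for t
      using power_mono[OF M[OF that], of 2] that by simp
    show "integrable lborel (\<lambda>t. M\<^sup>2 * indicat_real {0<..<1::real} t)"
      by (intro integrable_mult_right integrable_real_indicator) (auto intro: borel_open simp: emeasure_lborel_Ioo)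
  qed simp
  have "\<exists>U. open U \<and> V \<union> \<gamma> ` {0<..<1} \<subseteq> U \<and> Cinf_on U f" using U f by blast
  then show ?thesis
    unfolding trace_rel_def
    by (intro exI[of _ "\<lambda>_. f"] exI[of _ "ddl [1] f"] exI[of _ "ddl [\<i>] f"] conjI allI Lg L wd Lt Ld z)
      (auto simp only: i0 diff_self power_zero_numeral integral_zero intro: tendsto_const)
qed

lemma integral_lap_test_fn:
  assumes G: "open G" and f: "Cinf_on G f" and t: "test_fn G \<phi>"
  shows "integral\<^sup>L (lebesgue_on G) (\<lambda>z. f z * lap \<phi> z) = integral\<^sup>L (lebesgue_on G) (\<lambda>z. lap f z * \<phi> z)"
proof -
  have c: "continuous_on G (ddl vs f)" for vs by (rule Cinf_on_continuous[OF f])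
  have I: "integral\<^sup>L (lebesgue_on G) (\<lambda>z. f z * ddl [v] (ddl [v] \<phi>) z) = integral\<^sup>L (lebesgue_on G) (\<lambda>z. ddl [v] (ddl [v] f) z * \<phi> z)" for v
  proof -
    have A: "integral\<^sup>L (lebesgue_on G) (\<lambda>z. ddl [v] f z * ddl [v] \<phi> z) = - integral\<^sup>L (lebesgue_on G) (\<lambda>z. f z * ddl [v] (ddl [v] \<phi>) z)"
      by (rule weak_derivD[OF Cinf_imp_weak_deriv[OF G f] test_fn_ddl[OF t]])
    have B: "integral\<^sup>L (lebesgue_on G) (\<lambda>z. ddl [v] (ddl [v] f) z * \<phi> z) = - integral\<^sup>L (lebesgue_on G) (\<lambda>z. ddl [v] f z * ddl [v] \<phi> z)"
      by (rule weak_derivD[OF Cinf_imp_weak_deriv[OF G Cinf_on_ddl[OF f]] t])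
    show ?thesis unfolding B A by (rule minus_minus[symmetric])
  qed
  have "integral\<^sup>L (lebesgue_on G) (\<lambda>z. f z * lap \<phi> z)
    = integral\<^sup>L (lebesgue_on G) (\<lambda>z. ddl [] f z * ddl [1, 1] \<phi> z + ddl [] f z * ddl [\<i>, \<i>] \<phi> z)"
    by (simp add: lap_def distrib_left)
  also have "\<dots> = integral\<^sup>L (lebesgue_on G) (\<lambda>z. ddl [] f z * ddl [1, 1] \<phi> z) + integral\<^sup>L (lebesgue_on G) (\<lambda>z. ddl [] f z * ddl [\<i>, \<i>] \<phi> z)"
    by (intro Bochner_Integration.integral_add integrable_test_fn G test_fn_ddl t c)
  also have "\<dots> = integral\<^sup>L (lebesgue_on G) (\<lambda>z. ddl [1, 1] f z * \<phi> z) + integral\<^sup>L (lebesgue_on G) (\<lambda>z. ddl [\<i>, \<i>] f z * \<phi> z)"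
    using I[of 1] I[of \<i>] by simp
  also have "\<dots> = integral\<^sup>L (lebesgue_on G) (\<lambda>z. ddl [1, 1] f z * \<phi> z + ddl [\<i>, \<i>] f z * \<phi> z)"
    by (intro Bochner_Integration.integral_add[symmetric] integrable_test_fn G t c)
  finally show ?thesis by (simp add: lap_def distrib_right)
qed

section \<open>Boundary values of the singular function\<close>

context corner_function
begin

lemma u_axis:
  assumes "(z - p) / n = of_real r" "r > 0"
  shows "u z = bump p d z * r powr \<mu>"
  using assms(2) by (simp add: u_def re_powr_def assms(1) powr_of_real)

text \<open>The \<open>E2\<close> term is even in \<open>\<tau>\<close>, since \<open>Im\<close> and
  the imaginary part of the power both change sign; the \<open>E1\<close> term is odd. By
  \<open>sin (x - pi / 2) = - cos x\<close> the \<open>E2\<close> term carries the same cosine as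
  the real part, hence the factor \<open>1 - E2\<close>.\<close>

lemma u_side:
  assumes z: "(z - p) / n = \<i> * of_real \<tau> * of_real r" and r: "r > 0" and \<tau>: "\<tau> \<in> {1, -1}"
  shows "u z = bump p d z * r powr \<mu> * (cos (\<mu> * pi / 2) * (1 - E2 z) + \<tau> * sin (\<mu> * pi / 2) * E1 z)"
proof -
  have "Ln (\<i> * of_real \<tau>) = \<i> * of_real (\<tau> * pi / 2)"
    using \<tau> by auto
  moreover have "\<i> * of_real \<tau> * of_real r = of_real r * (\<i> * of_real \<tau>)" by simp
  moreover have "Ln (of_real r * (\<i> * of_real \<tau>)) = of_real (ln r) + Ln (\<i> * of_real \<tau>)"
    using r \<tau> Ln_times_of_real[of r "\<i> * of_real \<tau>"] by (force simp: Ln_of_real)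
  ultimately have "Ln (\<i> * of_real \<tau> * of_real r) = of_real (ln r) + \<i> * of_real (\<tau> * pi / 2)"
    by (simp only:)
  then have pow: "((z - p) / n) powr of_real a = of_real (r powr a) * cis (a * (\<tau> * pi / 2))" for a
    unfolding z using r \<tau>
    by (auto simp: powr_def cis_conv_exp exp_add[symmetric] exp_of_real[symmetric] algebra_simps)
  have cs: "cos (a * (\<tau> * pi / 2)) = cos (a * pi / 2)" "sin (a * (\<tau> * pi / 2)) = \<tau> * sin (a * pi / 2)" for a
    using \<tau> by auto
  have s1: "sin ((\<mu> - 1) * pi / 2) = - cos (\<mu> * pi / 2)"
    using sin_diff[of "\<mu> * pi / 2" "pi / 2"] by (simp add: algebra_simps diff_divide_distrib)
  have re: "Re (1 * (of_real R * cis x)) = R * cos x" "Re (- \<i> * (of_real R * cis x)) = R * sin x" for R x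
    by simp_all
  have pws: "re_powr p n 1 a z = r powr a * cos (a * pi / 2)" "re_powr p n (- \<i>) a z = r powr a * (\<tau> * sin (a * pi / 2))" for a
    unfolding re_powr_def pow re cs by (rule refl)+
  have "Im ((z - p) / n) = \<tau> * r" unfolding z by simp
  moreover have "re_powr p n (- \<i>) (\<mu> - 1) z = r powr (\<mu> - 1) * (\<tau> * - cos (\<mu> * pi / 2))"
    unfolding pws s1 by (rule refl)
  ultimately have "Im ((z - p) / n) * re_powr p n (- \<i>) (\<mu> - 1) z
      = - ((\<tau> * \<tau>) * (r * r powr (\<mu> - 1)) * cos (\<mu> * pi / 2))"
    by simp
  moreover have "r * r powr (\<mu> - 1) = r powr \<mu>" using r by (simp add: powr_diff)
  moreover have "\<tau> * \<tau> = 1" using \<tau> by auto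
  ultimately have "Im ((z - p) / n) * re_powr p n (- \<i>) (\<mu> - 1) z = - (r powr \<mu> * cos (\<mu> * pi / 2))"
    by simp
  then show ?thesis unfolding u_def mult.assoc by (simp add: algebra_simps pws)
qed

lemma W1_u:
  assumes G: "open G" and sl: "\<And>z. z \<in> G \<Longrightarrow> norm (z - p) < e \<Longrightarrow> z \<in> slit p n"
  shows "Cinf_on G u" "L2 G u" "L2 G (ddl [w] u)" "W1 G u"
proof -
  have "G \<subseteq> slit p n \<union> {z. d < norm (z - p)}" using sl de by force
  then show C: "Cinf_on G u" by (rule Cinf_on_subset[OF Cinf_u])
  \<comment> \<open>With \<open>\<sigma> = 1\<close> the rotation is the identity.\<close>
  have R: "length vs \<le> 1 \<Longrightarrow> L2 G (ddl vs u)" for vs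
    using rot_L2[where \<sigma>=1 and V=G and vs=vs] G sl by simp
  show "L2 G u" using R[of "[]"] by simp
  show L: "L2 G (ddl [w] u)" for w by (rule R) simp
  show "W1 G u" unfolding W1_def using \<open>L2 G u\<close> L Cinf_imp_weak_deriv[OF G C] by blast
qed

text \<open>Near \<open>p\<close>, \<open>F\<close> rotates the side in direction
  \<open>\<i> * \<tau>\<close> onto the axis. The two values of \<open>u\<close> share the factor
  cutoff times \<open>r^\<mu>\<close>, and assumption \<open>b\<close> says that the remaining
  bracket is zero. Beyond radius \<open>e\<close> all values vanish, so \<open>u \<circ> F\<close>
  may be replaced by the rotated \<open>u\<close>, which is smooth near the curve.\<close>

lemma nonlocal_condition:
  assumes G: "open G" and half: "G \<inter> ball p e = halfplane p n \<inter> ball p e"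
    and sl: "halfplane p n \<subseteq> slit p n"
    and \<gamma>: "continuous_on {0<..<1} \<gamma>"
    and F: "open Ui" "continuous_on Ui F" "inj_on F Ui" "\<gamma> ` {0<..<1} \<subseteq> Ui" "F ` (\<gamma> ` {0<..<1}) \<subseteq> G"
    and loc: "ball p e \<subseteq> Ui" "\<And>y. y \<in> ball p e \<Longrightarrow> F y = p + \<sigma> * (y - p)"
    and \<sigma>: "\<sigma> = - \<i> * of_real \<tau>" "\<tau> \<in> {1, -1}"
    and side: "\<And>y. y \<in> \<gamma> ` {0<..<1} \<Longrightarrow> norm (y - p) < e \<Longrightarrow>
        y \<noteq> p \<and> (y - p) / n = \<i> * of_real \<tau> * of_real (norm (y - p))"
    and b: "\<And>y. cos (\<mu> * pi / 2) * (1 - E2 y) + \<tau> * sin (\<mu> * pi / 2) * E1 y + b y = 0"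
  shows "\<exists>w0 w1. trace_rel G \<gamma> u w0 \<and> comp_trace_rel G Ui F \<gamma> u w1
     \<and> (\<forall>t\<in>{0<..<1}. w0 t + b (\<gamma> t) * w1 t = 0)"
proof -
  have n\<sigma>: "norm \<sigma> = 1" using \<sigma> by (auto simp: norm_mult)
  then have \<sigma>0: "\<sigma> \<noteq> 0" by auto
  have nz: "z \<in> ball p e \<longleftrightarrow> norm (z - p) < e" for z by (simp add: dist_norm norm_minus_commute)
  have slG: "z \<in> slit p n" if "z \<in> G" "norm (z - p) < e" for z
    using that half sl by (auto simp flip: nz)
  have R: "p - \<sigma> * p + \<sigma> * z = p + \<sigma> * (z - p)" for z by (simp add: algebra_simps)
  \<comment> \<open>\<open>F\<close> maps the disc about \<open>p\<close> onto itself, so by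
    injectivity no point outside the disc can land in it.\<close>
  have far: "norm (z - p) < e" if z: "z \<in> Ui" "norm (F z - p) < e" for z
  proof -
    define z' where "z' = p + (F z - p) / \<sigma>"
    have "norm (z' - p) < e" using z n\<sigma> by (simp add: z'_def norm_divide)
    then have "z' \<in> ball p e" by (simp only: nz)
    then have "F z' = F z" "z' \<in> Ui" using loc \<sigma>0 by (auto simp: z'_def)
    then have "z' = z" using F(3) z by (meson inj_onD)
    then show ?thesis using \<open>norm (z' - p) < e\<close> by simp
  qed
  have uF: "u (F z) = u (p - \<sigma> * p + \<sigma> * z)" if "z \<in> Ui" for z
  proof (cases "norm (z - p) < e")
    case True
    then have "z \<in> ball p e" by (simp only: nz)
    then show ?thesis by (simp only: loc(2) R)
  next
    case False
    then have "norm (F z - p) \<ge> e" using far[OF that] by fastforce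
    moreover have "norm (p - \<sigma> * p + \<sigma> * z - p) \<ge> e"
      unfolding R using False n\<sigma> by (simp add: norm_mult)
    ultimately show ?thesis using u_zero de by simp
  qed
  obtain M where M: "\<And>z. (norm (z - p) < e \<Longrightarrow> z \<in> slit p n) \<Longrightarrow> \<bar>u z\<bar> \<le> M" using u_bounded by blast
  have sl\<gamma>: "y \<in> slit p n" if "y \<in> \<gamma> ` {0<..<1}" "norm (y - p) < e" for y
  proof -
    have "(y - p) / n = \<i> * of_real \<tau> * of_real (norm (y - p))" "y \<noteq> p" using side[OF that] by auto
    then show ?thesis unfolding slit_def using \<sigma>(2)
      by (auto elim!: nonpos_Reals_cases simp: complex_eq_iff)
  qed
  have T0: "trace_rel G \<gamma> u (\<lambda>t. u (\<gamma> t))"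
  proof (rule trace_rel_smooth[OF G open_dom _ Cinf_u])
    show "G \<union> \<gamma> ` {0<..<1} \<subseteq> slit p n \<union> {z. d < norm (z - p)}"
      using slG sl\<gamma> de by force
    show "L2 G u" "L2 G (ddl [1] u)" "L2 G (ddl [\<i>] u)" using W1_u[OF G slG] by blast+
    show "\<bar>u (\<gamma> t)\<bar> \<le> M" if "t \<in> {0<..<1}" for t using M sl\<gamma> that by blast
  qed (use \<gamma> in auto)
  define V where "V = {z \<in> Ui. F z \<in> G}"
  have V: "open V"
    using continuous_open_preimage[OF F(2,1) G] by (simp add: V_def vimage_def Int_def)
  \<comment> \<open>A point of \<open>V\<close> near \<open>p\<close> is rotated into
    \<open>G\<close>, hence into the half-plane and off the cut.\<close>
  have VR: "p - \<sigma> * p + \<sigma> * z \<in> slit p n" if "z \<in> V" "norm (z - p) < e" for z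
  proof -
    have "F z = p + \<sigma> * (z - p)" using loc(2) that(2) nz by blast
    moreover have "F z \<in> slit p n"
      using that calculation n\<sigma> by (intro slG) (auto simp: V_def norm_mult)
    ultimately show ?thesis by (simp add: R)
  qed
  have \<gamma>V: "\<gamma> ` {0<..<1} \<subseteq> V" using F(4,5) by (auto simp: V_def)
  have T1: "trace_rel V \<gamma> (u \<circ> F) (\<lambda>t. u (p - \<sigma> * p + \<sigma> * \<gamma> t))"
  proof (rule trace_rel_smooth[OF V rot_dom(1)[OF n\<sigma> V VR] _ rot_Cinf[OF n\<sigma> V VR]])
    show "V \<union> \<gamma> ` {0<..<1} \<subseteq> (\<lambda>z. p - \<sigma> * p + \<sigma> * z) -` (slit p n \<union> {z. d < norm (z - p)})"
      using \<gamma>V rot_dom(2)[OF n\<sigma> V VR] by blast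
    show "L2 V (\<lambda>z. u (p - \<sigma> * p + \<sigma> * z))" using rot_L2[OF n\<sigma> V VR, of "[]"] by simp
    show "L2 V (ddl [1] (\<lambda>z. u (p - \<sigma> * p + \<sigma> * z)))" "L2 V (ddl [\<i>] (\<lambda>z. u (p - \<sigma> * p + \<sigma> * z)))"
      by (rule rot_L2[OF n\<sigma> V VR]; simp)+
    show "(u \<circ> F) z = u (p - \<sigma> * p + \<sigma> * z)" if "z \<in> V" for z
      using uF[of z] that by (simp add: V_def)
    show "\<bar>u (p - \<sigma> * p + \<sigma> * \<gamma> t)\<bar> \<le> M" if "t \<in> {0<..<1}" for t
    proof (rule M)
      assume "norm (p - \<sigma> * p + \<sigma> * \<gamma> t - p) < e"
      then have "norm (\<gamma> t - p) < e" unfolding R using n\<sigma> by (simp add: norm_mult)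
      then show "p - \<sigma> * p + \<sigma> * \<gamma> t \<in> slit p n" using VR \<gamma>V that by blast
    qed
  qed (use \<gamma> in auto)
  have "u (\<gamma> t) + b (\<gamma> t) * u (p - \<sigma> * p + \<sigma> * \<gamma> t) = 0" if t: "t \<in> {0<..<1}" for t
  proof (cases "norm (\<gamma> t - p) < e")
    case True
    define r where "r = norm (\<gamma> t - p)"
    have y: "\<gamma> t \<noteq> p" "(\<gamma> t - p) / n = \<i> * of_real \<tau> * of_real r" using side[of "\<gamma> t"] t True by (auto simp: r_def)
    then have r: "r > 0" by (simp add: r_def)
    have "(p - \<sigma> * p + \<sigma> * \<gamma> t - p) / n = \<sigma> * ((\<gamma> t - p) / n)" by (simp add: algebra_simps diff_divide_distrib)
    also have "\<dots> = of_real r" unfolding y(2) \<sigma>(1) using \<sigma>(2) by auto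
    finally have "u (p - \<sigma> * p + \<sigma> * \<gamma> t) = bump p d (p - \<sigma> * p + \<sigma> * \<gamma> t) * r powr \<mu>"
      using r by (rule u_axis)
    \<comment> \<open>The cutoff is radial, so the rotation leaves it unchanged.\<close>
    moreover have "bump p d (p - \<sigma> * p + \<sigma> * \<gamma> t) = bump p d (\<gamma> t)"
      unfolding R bump_def using n\<sigma> by (simp add: norm_mult)
    moreover have "u (\<gamma> t) = bump p d (\<gamma> t) * r powr \<mu> * (cos (\<mu> * pi / 2) * (1 - E2 (\<gamma> t)) + \<tau> * sin (\<mu> * pi / 2) * E1 (\<gamma> t))"
      by (rule u_side[OF y(2) r \<sigma>(2)])
    ultimately have "u (\<gamma> t) + b (\<gamma> t) * u (p - \<sigma> * p + \<sigma> * \<gamma> t) = bump p d (\<gamma> t) * r powr \<mu> *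
       (cos (\<mu> * pi / 2) * (1 - E2 (\<gamma> t)) + \<tau> * sin (\<mu> * pi / 2) * E1 (\<gamma> t) + b (\<gamma> t))"
      by (simp only: distrib_left mult_ac)
    then show ?thesis by (simp only: b mult_zero_right)
  next
    case False
    moreover have "norm (p - \<sigma> * p + \<sigma> * \<gamma> t - p) \<ge> e"
      unfolding R using False n\<sigma> by (simp add: norm_mult)
    ultimately show ?thesis using u_zero de by simp
  qed
  moreover have "comp_trace_rel G Ui F \<gamma> u (\<lambda>t. u (p - \<sigma> * p + \<sigma> * \<gamma> t))"
    unfolding comp_trace_rel_def using V \<gamma>V T1 by (intro exI[of _ V]) (auto simp: V_def)
  ultimately show ?thesis using T0 by blast
qed

text \<open>The curve is mapped to distance at least \<open>e > d\<close> from \<open>p\<close>; on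
  the neighbourhood \<open>V\<close> of it the images avoid the points where \<open>u\<close> is
  nonzero, and the composite is identically zero.\<close>

lemma trace_far:
  assumes "open G" "open U" "continuous_on U F" "\<gamma> ` {0<..<1} \<subseteq> U" "F ` (\<gamma> ` {0<..<1}) \<subseteq> G"
    and far: "\<And>y. y \<in> F ` (\<gamma> ` {0<..<1}) \<Longrightarrow> e \<le> norm (y - p)"
    and \<gamma>: "continuous_on {0<..<1} \<gamma>"
  shows "comp_trace_rel G U F \<gamma> u (\<lambda>_. 0)"
proof -
  let ?G = "G \<inter> {z. d < norm (z - p)}"
  define V where "V = U \<inter> F -` ?G"
  have "open ?G" using assms(1) by (intro open_Int open_Collect_less continuous_intros)
  then have V: "open V" unfolding V_def by (rule continuous_open_preimage[OF assms(3,2)])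
  have "trace_rel V \<gamma> (u \<circ> F) (\<lambda>t. (\<lambda>_. 0) (\<gamma> t))"
    by (rule trace_rel_smooth[OF V open_UNIV _ Cinf_on_const _ _ _ _ \<gamma>])
      (auto simp: L2_zero V_def u_zero simp del: ddl.simps(2) simp: ddl_zero)
  moreover have "\<gamma> ` {0<..<1} \<subseteq> V" "V \<subseteq> U" "F ` V \<subseteq> G"
    using assms(4,5) far de by (force simp: V_def)+
  ultimately show ?thesis unfolding comp_trace_rel_def using V by auto
qed

end

section \<open>Geometry of the boundary at a corner\<close>

lemma halfplane_sgn:
  assumes "n \<noteq> 0" shows "halfplane p (sgn n) = halfplane p n"
proof -
  have "Re ((z - p) * cnj (sgn n)) = Re ((z - p) * cnj n) / norm n" for z
    by (simp add: sgn_eq diff_divide_distrib add_divide_distrib)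
  then show ?thesis using assms by (simp add: halfplane_def zero_less_divide_iff)
qed

text \<open>A point beyond the line has a neighbourhood that misses \<open>G\<close>; a point on the
  line is approached from \<open>G\<close> along \<open>n\<close>.\<close>

lemma frontier_halfplane_local:
  assumes n: "norm n = 1" and G: "open G" and half: "G \<inter> ball p e = halfplane p n \<inter> ball p e"
    and y: "norm (y - p) < e"
  shows "y \<in> frontier G \<longleftrightarrow> Re ((y - p) / n) = 0"
proof -
  have yb: "y \<in> ball p e" using y by (simp add: dist_norm norm_minus_commute)
  have fr: "frontier G = closure G - G" using G by (simp add: frontier_def interior_open)
  have n0: "n \<noteq> 0" using n by auto
  have H: "x \<in> G \<longleftrightarrow> Re ((x - p) / n) > 0" if "x \<in> ball p e" for x
    using half that unfolding halfplane_unit[OF n] by blast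
  show ?thesis
  proof
    assume "y \<in> frontier G"
    then have "y \<in> closure G" "\<not> Re ((y - p) / n) > 0" using fr H[OF yb] by auto
    moreover have "\<not> Re ((y - p) / n) < 0"
    proof
      assume neg: "Re ((y - p) / n) < 0"
      let ?N = "ball p e \<inter> {x. Re ((x - p) / n) < 0}"
      have "open ?N" using n0 by (intro open_Int open_ball open_Collect_less continuous_intros) auto
      moreover have "?N \<inter> G = {}" using H by force
      ultimately have "?N \<inter> closure G = {}" by (simp add: open_Int_closure_eq_empty)
      then show False using neg yb \<open>y \<in> closure G\<close> by blast
    qed
    ultimately show "Re ((y - p) / n) = 0" by linarith
  next
    assume R0: "Re ((y - p) / n) = 0"
    have "y \<in> closure G" unfolding closure_approachable
    proof (intro allI impI)
      fix \<delta> :: real assume "\<delta> > 0"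
      define s where "s = min (\<delta> / 2) ((e - norm (y - p)) / 2)"
      have s: "0 < s" "s < \<delta>" "s < e - norm (y - p)" using \<open>\<delta> > 0\<close> y by (auto simp: s_def min_def)
      let ?x = "y + of_real s * n"
      have "norm (?x - p) \<le> norm (y - p) + norm (of_real s * n)"
        using norm_triangle_ineq[of "y - p" "of_real s * n"] by (simp add: algebra_simps)
      then have "?x \<in> ball p e" using s n by (simp add: dist_norm norm_minus_commute norm_mult)
      moreover have "(?x - p) / n = (y - p) / n + of_real s" using n0 by (simp add: field_simps)
      then have "Re ((?x - p) / n) > 0" using R0 s by simp
      ultimately have "?x \<in> G" using H by blast
      moreover have "dist ?x y < \<delta>" using s n by (simp add: dist_norm norm_mult)
      ultimately show "\<exists>x\<in>G. dist x y < \<delta>" by blast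
    qed
    then show "y \<in> frontier G" using fr H[OF yb] R0 by simp
  qed
qed

text \<open>The rotated point lies in \<open>G\<close>, hence in the half-plane, and for
  \<open>Re w = 0\<close> this forces \<open>\<tau> * Im w > 0\<close>. The sense of rotation thus
  decides which half of the boundary line carries the curve.\<close>

lemma side_direction:
  assumes n: "norm n = 1" and G: "open G" and half: "G \<inter> ball p e = halfplane p n \<inter> ball p e"
    and y: "y \<in> frontier G" "norm (y - p) < e" "F y \<in> G"
    and loc: "\<And>y. y \<in> ball p e \<Longrightarrow> F y = p + \<sigma> * (y - p)"
    and \<sigma>: "\<sigma> = - \<i> * of_real \<tau>" "\<tau> \<in> {1, -1}"
  shows "y \<noteq> p \<and> (y - p) / n = \<i> * of_real \<tau> * of_real (norm (y - p))"
proof -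
  define w where "w = (y - p) / n"
  have yb: "y \<in> ball p e" using y by (simp add: dist_norm norm_minus_commute)
  have "Re w = 0" using frontier_halfplane_local[OF n G half y(2)] y(1) by (simp add: w_def)
  then have w: "w = \<i> * of_real (Im w)" by (simp add: complex_eq_iff)
  have nw: "norm w = norm (y - p)" using n by (simp add: w_def norm_divide)
  have Fy: "F y = p + \<sigma> * (y - p)" by (rule loc[OF yb])
  have "norm (F y - p) = norm (y - p)" unfolding Fy using \<sigma> by (auto simp: norm_mult)
  then have "F y \<in> ball p e" using y(2) by (simp add: dist_norm norm_minus_commute)
  then have "Re ((F y - p) / n) > 0" using half y(3) unfolding halfplane_unit[OF n] by blast
  moreover have "(F y - p) / n = \<sigma> * w" by (simp add: Fy w_def)
  ultimately have "Re (\<sigma> * w) > 0" by simp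
  then have pos: "\<tau> * Im w > 0" by (simp add: \<sigma>(1))
  have "norm w = \<bar>Im w\<bar>" using \<open>Re w = 0\<close> by (simp add: cmod_def)
  then have "Im w = \<tau> * norm (y - p)" using pos \<sigma>(2) nw by (auto simp: abs_if split: if_splits)
  then show ?thesis using w pos nw by (auto simp: w_def)
qed

lemma corner_solution:
  assumes ex: "example_setting G g h \<gamma>1 \<gamma>2 b1 b2 a U1 \<Omega>1 U2 \<Omega>2 U \<Omega>"
    and p: "p \<in> {g, h}" and \<beta>: "b1 p + b2 p \<in> {-2<..<0}"
  shows "\<exists>f0 u. L2 G f0
           \<and> gen_solution G \<gamma>1 \<gamma>2 b1 b2 a U1 \<Omega>1 U2 \<Omega>2 U \<Omega> f0 (\<lambda>_. 0) (\<lambda>_. 0) u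
           \<and> \<not> W2 G u"
proof -
  have G: "open G" and arcs: "smooth_arc \<gamma>1" "smooth_arc \<gamma>2"
    and ends: "\<gamma>1 0 = g" "\<gamma>1 1 = h" "\<gamma>2 0 = g" "\<gamma>2 1 = h"
    and fr: "frontier G = \<gamma>1 ` {0<..<1} \<union> \<gamma>2 ` {0<..<1} \<union> {g, h}"
    and half0: "\<forall>p\<in>{g, h}. \<exists>n e. n \<noteq> 0 \<and> e > 0 \<and> G \<inter> ball p e = halfplane p n \<inter> ball p e"
    and bs: "Cinf_on UNIV b1" "Cinf_on UNIV b2"
    and om: "\<forall>(\<gamma>, Ui, \<Omega>i) \<in> {(\<gamma>1, U1, \<Omega>1), (\<gamma>2, U2, \<Omega>2)}.
        Cinf_diffeo_on Ui \<Omega>i \<and> \<gamma> ` {0..1} \<subseteq> Ui \<and> \<Omega>i ` (\<gamma> ` {0<..<1}) \<subseteq> G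
        \<and> \<Omega>i g = g \<and> \<Omega>i h = h
        \<and> (\<forall>p\<in>{g, h}. \<exists>e>0. \<exists>\<sigma>\<in>{\<i>, -\<i>}. ball p e \<subseteq> Ui
              \<and> (\<forall>y\<in>ball p e. \<Omega>i y = p + \<sigma> * (y - p)))"
    and U: "Cinf_diffeo_on U \<Omega>" "\<gamma>1 ` {0<..<1} \<subseteq> U" "\<Omega> ` (\<gamma>1 ` {0<..<1}) \<subseteq> G"
      "closure (\<Omega> ` (\<gamma>1 ` {0<..<1})) \<inter> {g, h} = {}"
    using ex unfolding example_setting_def by - (elim conjE, assumption)+
  have arc: "continuous_on {0<..<1} \<gamma>" "inj_on \<gamma> {0..1}" if arc: "smooth_arc \<gamma>" for \<gamma>
  proof -
    obtain \<epsilon> where "\<epsilon> > 0" "Cinf_on {-\<epsilon><..<1+\<epsilon>} \<gamma>"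
      using arc by (auto simp: smooth_arc_def)
    then show "continuous_on {0<..<1} \<gamma>"
      using Cinf_on_continuous[of "{-\<epsilon><..<1+\<epsilon>}" \<gamma> "[]"] by (auto intro: continuous_on_subset)
    show "inj_on \<gamma> {0..1}" using that by (simp add: smooth_arc_def)
  qed
  have diffeo: "open V" "continuous_on V F" "inj_on F V" if "Cinf_diffeo_on V F" for V F
    using that Cinf_on_continuous[of V F "[]"] unfolding Cinf_diffeo_on_def by auto
  have om1: "Cinf_diffeo_on U1 \<Omega>1" "\<gamma>1 ` {0..1} \<subseteq> U1" "\<Omega>1 ` (\<gamma>1 ` {0<..<1}) \<subseteq> G"
    and om2: "Cinf_diffeo_on U2 \<Omega>2" "\<gamma>2 ` {0..1} \<subseteq> U2" "\<Omega>2 ` (\<gamma>2 ` {0<..<1}) \<subseteq> G"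
    using om by simp_all
  have "\<exists>e>0. \<exists>\<sigma>\<in>{\<i>, -\<i>}. ball p e \<subseteq> U1 \<and> (\<forall>y\<in>ball p e. \<Omega>1 y = p + \<sigma> * (y - p))"
    "\<exists>e>0. \<exists>\<sigma>\<in>{\<i>, -\<i>}. ball p e \<subseteq> U2 \<and> (\<forall>y\<in>ball p e. \<Omega>2 y = p + \<sigma> * (y - p))"
    using om p by blast+
  then obtain e1 \<sigma>1 e2 \<sigma>2 where
    e1: "e1 > 0" "\<sigma>1 \<in> {\<i>, -\<i>}" "ball p e1 \<subseteq> U1" "\<And>y. y \<in> ball p e1 \<Longrightarrow> \<Omega>1 y = p + \<sigma>1 * (y - p)"
    and e2: "e2 > 0" "\<sigma>2 \<in> {\<i>, -\<i>}" "ball p e2 \<subseteq> U2" "\<And>y. y \<in> ball p e2 \<Longrightarrow> \<Omega>2 y = p + \<sigma>2 * (y - p)"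
    by blast
  obtain n0 e0 where e0: "n0 \<noteq> 0" "e0 > 0" "G \<inter> ball p e0 = halfplane p n0 \<inter> ball p e0"
    using half0 p by blast
  have "p \<in> - closure (\<Omega> ` (\<gamma>1 ` {0<..<1}))" using U(4) p by blast
  then obtain e3 where e3: "e3 > 0" "ball p e3 \<subseteq> - closure (\<Omega> ` (\<gamma>1 ` {0<..<1}))"
    using open_contains_ball[of "- closure (\<Omega> ` (\<gamma>1 ` {0<..<1}))"] by blast
  define e where "e = min (min 1 e0) (min e3 (min e1 e2))"
  have e: "0 < e" "e \<le> 1" "e \<le> e0" "e \<le> e1" "e \<le> e2" "e \<le> e3"
    using e0 e1 e2 e3 by (auto simp: e_def)
  define n where "n = sgn n0"
  have n: "norm n = 1" using e0 by (simp add: n_def norm_sgn)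
  then have nn0: "n \<noteq> 0" by auto
  have half: "G \<inter> ball p e = halfplane p n \<inter> ball p e"
  proof -
    have "ball p e = ball p e0 \<inter> ball p e" using e by auto
    then show ?thesis using e0(3) halfplane_sgn[OF e0(1)] by (metis Int_assoc n_def)
  qed
  \<comment> \<open>Sign convention: the rotation by \<open>\<sigma> = - \<i> * \<tau>\<close>
    carries the half-line in direction \<open>\<i> * \<tau>\<close> to the positive axis.\<close>
  define \<tau>1 where "\<tau>1 = - Im \<sigma>1"
  define \<tau>2 where "\<tau>2 = - Im \<sigma>2"
  have \<sigma>1: "\<sigma>1 = - \<i> * of_real \<tau>1" "\<tau>1 \<in> {1, -1}" and \<sigma>2: "\<sigma>2 = - \<i> * of_real \<tau>2" "\<tau>2 \<in> {1, -1}"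
    using e1(2) e2(2) by (auto simp: \<tau>1_def \<tau>2_def)
  have loc1: "\<Omega>1 y = p + \<sigma>1 * (y - p)" and loc2: "\<Omega>2 y = p + \<sigma>2 * (y - p)" if "y \<in> ball p e" for y
    using that e e1(4) e2(4) by auto
  have side1: "y \<noteq> p \<and> (y - p) / n = \<i> * of_real \<tau>1 * of_real (norm (y - p))"
    if "y \<in> \<gamma>1 ` {0<..<1}" "norm (y - p) < e" for y
    using that fr om1(3) by (intro side_direction[OF n G half _ _ _ loc1 \<sigma>1]) auto
  have side2: "y \<noteq> p \<and> (y - p) / n = \<i> * of_real \<tau>2 * of_real (norm (y - p))"
    if "y \<in> \<gamma>2 ` {0<..<1}" "norm (y - p) < e" for y
    using that fr om2(3) by (intro side_direction[OF n G half _ _ _ loc2 \<sigma>2]) auto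
  \<comment> \<open>The curves leave \<open>p\<close> along opposite half-lines. A point at distance
    \<open>s\<close> on the half-line opposite to that of \<open>\<gamma>1\<close> lies on the
    frontier, is no corner since \<open>0 < s < norm (g - h)\<close>, and so belongs to
    \<open>\<gamma>2\<close>.\<close>
  have \<tau>: "\<tau>2 = - \<tau>1"
  proof -
    have gh: "g \<noteq> h" using inj_onD[OF arc(2)[OF arcs(1)], of 0 1] ends by auto
    define s where "s = min (e / 2) (norm (g - h) / 2)"
    have s: "0 < s" "s < e" "s < norm (g - h)" using e gh by (auto simp: s_def min_def)
    define y where "y = p - n * (\<i> * of_real \<tau>1 * of_real s)"
    have yp: "(y - p) / n = - (\<i> * of_real \<tau>1 * of_real s)" using nn0 by (simp add: y_def)
    have ny: "norm (y - p) = s" using n s \<sigma>1(2) by (auto simp: y_def norm_mult)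
    have "y \<in> frontier G"
      using frontier_halfplane_local[OF n G half, of y] ny s yp by simp
    moreover have "y \<noteq> g" "y \<noteq> h" using ny s p by (auto simp: norm_minus_commute)
    moreover have "y \<notin> \<gamma>1 ` {0<..<1}"
      using side1[of y] ny s yp \<sigma>1(2) by (auto simp: complex_eq_iff)
    ultimately have "y \<in> \<gamma>2 ` {0<..<1}" using fr by blast
    then have "\<i> * of_real \<tau>2 * of_real s = - (\<i> * of_real \<tau>1 * of_real s)"
      using side2[of y] ny s yp by simp
    then have "\<tau>2 * s = (- \<tau>1) * s" by (simp add: complex_eq_iff)
    then show ?thesis unfolding mult_cancel_right using s by simp
  qed
  \<comment> \<open>The interval \<open>(-2, 0)\<close> enters here: it puts the cosine of
    \<open>\<theta>\<close> into \<open>(0, 1)\<close>, hence \<open>\<theta>\<close> into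
    \<open>(0, pi / 2)\<close> and \<open>\<mu>\<close> into \<open>(0, 1)\<close>.\<close>
  define \<theta> where "\<theta> = arccos (- (b1 p + b2 p) / 2)"
  define \<mu> where "\<mu> = 2 * \<theta> / pi"
  have cos\<theta>: "cos \<theta> = - (b1 p + b2 p) / 2" unfolding \<theta>_def using \<beta> by (intro cos_arccos) auto
  have \<theta>: "0 < \<theta>" "\<theta> < pi / 2"
    using arccos_lt_bounded[of "- (b1 p + b2 p) / 2"] arccos_less_arccos[of 0 "- (b1 p + b2 p) / 2"] \<beta>
    by (auto simp: \<theta>_def)
  have mu: "0 < \<mu>" "\<mu> < 1" "\<mu> * pi / 2 = \<theta>" using \<theta> by (auto simp: \<mu>_def field_simps)
  have sin\<theta>: "sin \<theta> > 0" using \<theta> by (intro sin_gt_zero) auto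
  have cos0: "cos \<theta> > 0" using \<theta> by (intro cos_gt_zero_pi) auto
  \<comment> \<open>Solution of the equations \<open>k1\<close> and \<open>k2\<close> below, linear
    in \<open>1 - E2\<close> and \<open>E1\<close>: as \<open>\<tau>2 = - \<tau>1\<close>, adding
    them gives \<open>E2\<close> and subtracting gives \<open>E1\<close>. The choice of
    \<open>\<theta>\<close> makes \<open>E2 p = 0\<close>.\<close>
  define E1 where "E1 = (\<lambda>z. \<tau>1 / (2 * sin \<theta>) * (b2 z + (-1) * b1 z))"
  define E2 where "E2 = (\<lambda>z. 1 + 1 / (2 * cos \<theta>) * (b1 z + b2 z))"
  have CE: "Cinf_on UNIV E1" "Cinf_on UNIV E2"
    unfolding E1_def E2_def by (intro Cinf_on_add Cinf_on_mult Cinf_on_const bs open_UNIV)+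
  have E2p: "E2 p = 0" using cos0 cos\<theta> by (simp add: E2_def field_simps)
  interpret corner_function p n \<mu> "e / 2" e E1 E2
    by unfold_locales (use n mu e CE E2p in auto)
  note sl = halfplane_subset_slit[OF n, of p]
  have slG: "z \<in> slit p n" if "z \<in> G" "norm (z - p) < e" for z
  proof -
    have "z \<in> ball p e" using that by (simp add: dist_norm norm_minus_commute)
    then show ?thesis using that half sl by blast
  qed
  have c1: "cos \<theta> * (1 - E2 y) = - (b1 y + b2 y) / 2" for y
  proof -
    have "1 - E2 y = - (b1 y + b2 y) / (2 * cos \<theta>)" by (simp add: E2_def minus_divide_left)
    then show ?thesis using cos0 by simp
  qed
  have c2: "sin \<theta> * E1 y = \<tau>1 * (b2 y - b1 y) / 2" for y using sin\<theta> by (simp add: E1_def)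
  have t1: "\<tau>1 * \<tau>1 = 1" using \<sigma>1(2) by auto
  have k1: "cos (\<mu> * pi / 2) * (1 - E2 y) + \<tau>1 * sin (\<mu> * pi / 2) * E1 y + b1 y = 0" for y
  proof -
    have "\<tau>1 * sin \<theta> * E1 y = (\<tau>1 * \<tau>1) * (b2 y - b1 y) / 2" using c2[of y] by simp
    then show ?thesis unfolding mu(3) c1 t1 by (simp add: field_simps)
  qed
  have k2: "cos (\<mu> * pi / 2) * (1 - E2 y) + \<tau>2 * sin (\<mu> * pi / 2) * E1 y + b2 y = 0" for y
  proof -
    have "\<tau>2 * sin \<theta> * E1 y = - (\<tau>1 * \<tau>1) * (b2 y - b1 y) / 2" using c2[of y] by (simp add: \<tau>)
    then show ?thesis unfolding mu(3) c1 t1 by (simp add: field_simps)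
  qed
  have sub: "\<gamma>1 ` {0<..<1} \<subseteq> U1" "\<gamma>2 ` {0<..<1} \<subseteq> U2" "ball p e \<subseteq> U1" "ball p e \<subseteq> U2"
    using om1(2) om2(2) e1(3) e2(3) e by (auto simp: subset_iff)
  have N1: "\<exists>w0 w1. trace_rel G \<gamma>1 u w0 \<and> comp_trace_rel G U1 \<Omega>1 \<gamma>1 u w1
     \<and> (\<forall>t\<in>{0<..<1}. w0 t + b1 (\<gamma>1 t) * w1 t = 0)"
    by (rule nonlocal_condition[OF G half sl arc(1)[OF arcs(1)] diffeo[OF om1(1)] sub(1) om1(3) sub(3) loc1 \<sigma>1 side1 k1])
  have N2: "\<exists>w0 w1. trace_rel G \<gamma>2 u w0 \<and> comp_trace_rel G U2 \<Omega>2 \<gamma>2 u w1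
     \<and> (\<forall>t\<in>{0<..<1}. w0 t + b2 (\<gamma>2 t) * w1 t = 0)"
    by (rule nonlocal_condition[OF G half sl arc(1)[OF arcs(2)] diffeo[OF om2(1)] sub(2) om2(3) sub(4) loc2 \<sigma>2 side2 k2])
  have far: "e \<le> norm (y - p)" if "y \<in> \<Omega> ` (\<gamma>1 ` {0<..<1})" for y
  proof (rule ccontr)
    assume "\<not> e \<le> norm (y - p)"
    then have "y \<in> ball p e3" using e by (simp add: dist_norm norm_minus_commute)
    then show False using e3(2) that closure_subset[of "\<Omega> ` (\<gamma>1 ` {0<..<1})"] by blast
  qed
  have N3: "comp_trace_rel G U \<Omega> \<gamma>1 u (\<lambda>_. 0)"
    by (rule trace_far[OF G diffeo(1,2)[OF U(1)] U(2,3) far arc(1)[OF arcs(1)]])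
  \<comment> \<open>The real part of \<open>c0\<close> is the bump at its centre, which is
    nonzero.\<close>
  have c0: "c0 \<noteq> 0"
    using bump_eq_0_iff[of "e / 2" p p] e by (auto simp: c0_def complex_eq_iff)
  have AE: "AE t in lebesgue_on {0<..<1::real}. P t" if "\<forall>t\<in>{0<..<1}. P t" for P
    using that by (intro AE_I2) (simp add: space_restrict_space)
  have "gen_solution G \<gamma>1 \<gamma>2 b1 b2 a U1 \<Omega>1 U2 \<Omega>2 U \<Omega> (lap u) (\<lambda>_. 0) (\<lambda>_. 0) u"
    unfolding gen_solution_def
  proof (intro conjI allI impI)
    show "W1 G u" by (rule W1_u(4)[OF G slG])
    show "integral\<^sup>L (lebesgue_on G) (\<lambda>z. u z * lap \<phi> z) = integral\<^sup>L (lebesgue_on G) (\<lambda>z. lap u z * \<phi> z)"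
      if "test_fn G \<phi>" for \<phi> by (rule integral_lap_test_fn[OF G W1_u(1)[OF G slG] that])
    obtain w0 w1 where "trace_rel G \<gamma>1 u w0" "comp_trace_rel G U1 \<Omega>1 \<gamma>1 u w1"
      "\<forall>t\<in>{0<..<1}. w0 t + b1 (\<gamma>1 t) * w1 t = 0" using N1 by blast
    then show "\<exists>w0 w1 w2. trace_rel G \<gamma>1 u w0 \<and> comp_trace_rel G U1 \<Omega>1 \<gamma>1 u w1
        \<and> comp_trace_rel G U \<Omega> \<gamma>1 u w2
        \<and> (AE t in lebesgue_on {0<..<1}. w0 t + b1 (\<gamma>1 t) * w1 t + a (\<gamma>1 t) * w2 t = 0)"
      using N3 by (intro exI[of _ w0] exI[of _ w1] exI[of _ "\<lambda>_. 0"] conjI AE) auto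
    show "\<exists>w0 w1. trace_rel G \<gamma>2 u w0 \<and> comp_trace_rel G U2 \<Omega>2 \<gamma>2 u w1
        \<and> (AE t in lebesgue_on {0<..<1}. w0 t + b2 (\<gamma>2 t) * w1 t = 0)"
      using N2 AE by blast
  qed
  moreover have "L2 G (lap u)" by (rule L2_lap[OF G slG])
  moreover have "\<not> W2 G u" by (rule not_W2[OF G half c0])
  ultimately show ?thesis by blast
qed

theorem theorem7p3:
  assumes "example_setting G g h \<gamma>1 \<gamma>2 b1 b2 a U1 \<Omega>1 U2 \<Omega>2 U \<Omega>"
    and "b1 g + b2 g \<in> {-2<..<0} \<or> b1 h + b2 h \<in> {-2<..<0}"
  shows "\<exists>f0 u. L2 G f0
           \<and> gen_solution G \<gamma>1 \<gamma>2 b1 b2 a U1 \<Omega>1 U2 \<Omega>2 U \<Omega> f0 (\<lambda>_. 0) (\<lambda>_. 0) u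
           \<and> \<not> W2 G u"
  using assms corner_solution[OF assms(1)] by blast

end
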